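(* Assume $|V|\ge2$ and let $\overline\kappa_0=\inf_{x\ne y}\overline\kappa(x,y)$. Then for every $f\in\mathrm{Lip}^1_w(V)$, all $x,y\in V$ and all $t>0$, $$\frac{h_tf(x)}{d_x}-\frac{h_tf(y)}{d_y}\le e^{-\overline\kappa_0t}\,d(x,y).$$
   Context: Let $H=(V,E,w)$ be a weighted hypergraph: $V$ is a finite set, $E$ a set of nonempty subsets of $V$, $w\colon E\to\mathbb{R}_{>0}$. Write $x\sim y$ if some $e\in E$ contains both; $H$ is assumed connected. The degree is $d_x=\sum_{e\ni x}w_e>0$, $D=\mathrm{diag}(d_x)$. The distance $d(x,y)$ is the minimal $n$ with a chain $x=z_0\sim\cdots\sim z_n=y$. $\delta_x$ is the indicator of $x$. $\mathbb{R}^V$ carries the inner product $\langle f,g\rangle=\sum_x f(x)g(x)/d_x$ with norm $\|\cdot\|$. For $e\in E$ let $B_e=\mathrm{Conv}\{\delta_x-\delta_y : x,y\in e\}$. The multivalued hypergraph Laplacian is $L(f)=\{\sum_{e}w_e\mathtt{b}_e(\mathtt{b}_e^\top f) : \mathtt{b}_e\in\operatorname{argmax}_{\mathtt b\in B_e}\mathtt b^\top f\}$ and the normalized Laplacian is $\mathcal{L}f=L(D^{-1}f)$, a maximal monotone operator on $(\mathbb{R}^V,\langle\cdot,\cdot\rangle)$. For $\lambda>0$ the resolvent $J_\lambda=(I+\lambda\mathcal L)^{-1}$ is a single-valued map $\mathbb{R}^V\to\mathbb{R}^V$ (equivalently $J_\lambda f=\operatorname{argmin}_g\{\frac{1}{2\lambda}\|f-g\|^2+Q(D^{-1}g)\}$,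 $Q(g)=\frac12\sum_e w_e\max_{x,y\in e}(g(x)-g(y))^2$). The heat semigroup $h_t=e^{-t\mathcal L}$ is given by $h_tf=\lim_{\lambda\downarrow0}J_\lambda^{[t/\lambda]}f$ for $t>0$, $[a]$ the integer part. A function $f$ is weighted $1$-Lipschitz if $|f(x)/d_x-f(y)/d_y|\le d(x,y)$ for all $x,y$; $\mathrm{Lip}^1_w(V)$ denotes the set of such functions. $\mathrm{KD}_\lambda(x,y)=\sup\{\langle J_\lambda f,\delta_x-\delta_y\rangle : f\in\mathrm{Lip}^1_w(V)\}$. For $x\ne y$: $\kappa_\lambda(x,y)=1-\mathrm{KD}_\lambda(x,y)/d(x,y)$ and $\overline\kappa(x,y)=\limsup_{\lambda\downarrow0}\kappa_\lambda(x,y)/\lambda$. *)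

theory Defs
  imports Complex_Main "HOL-Library.Liminf_Limsup" "HOL-Library.Extended_Real"
begin

text \<open>Weighted hypergraph on the finite vertex type 'v (V = UNIV),
  hyperedges E :: 'v set set, weights w.\<close>

definition hg_adj :: "'v set set \<Rightarrow> 'v \<Rightarrow> 'v \<Rightarrow> bool" where
  "hg_adj E x y \<longleftrightarrow> (\<exists>e\<in>E. x \<in> e \<and> y \<in> e)"

definition hg_connected :: "'v set set \<Rightarrow> bool" where
  "hg_connected E \<longleftrightarrow> (\<forall>x y. \<exists>n. (hg_adj E ^^ n) x y)"

definition hg_dist :: "'v set set \<Rightarrow> 'v \<Rightarrow> 'v \<Rightarrow> nat" where
  "hg_dist E x y = (LEAST n. (hg_adj E ^^ n) x y)"

definition hg_deg :: "'v set set \<Rightarrow> ('v set \<Rightarrow> real) \<Rightarrow> 'v \<Rightarrow> real" where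
  "hg_deg E w x = (\<Sum>e\<in>{e\<in>E. x \<in> e}. w e)"

definition weighted_hypergraph :: "'v::finite set set \<Rightarrow> ('v set \<Rightarrow> real) \<Rightarrow> bool" where
  "weighted_hypergraph E w \<longleftrightarrow>
     (\<forall>e\<in>E. e \<noteq> {}) \<and> (\<forall>e\<in>E. 0 < w e) \<and> hg_connected E \<and> (\<forall>x. 0 < hg_deg E w x)"

definition hg_inner :: "'v::finite set set \<Rightarrow> ('v set \<Rightarrow> real) \<Rightarrow> ('v \<Rightarrow> real) \<Rightarrow> ('v \<Rightarrow> real) \<Rightarrow> real" where
  "hg_inner E w f g = (\<Sum>x\<in>UNIV. f x * g x / hg_deg E w x)"

definition hg_Q :: "'v::finite set set \<Rightarrow> ('v set \<Rightarrow> real) \<Rightarrow> ('v \<Rightarrow> real) \<Rightarrow> real" where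
  "hg_Q E w g = 1/2 * (\<Sum>e\<in>E. w e * (Max {g x - g y | x y. x \<in> e \<and> y \<in> e})\<^sup>2)"

definition hg_resolvent :: "'v::finite set set \<Rightarrow> ('v set \<Rightarrow> real) \<Rightarrow> real \<Rightarrow> ('v \<Rightarrow> real) \<Rightarrow> ('v \<Rightarrow> real)" where
  "hg_resolvent E w l f =
     (let F = (\<lambda>g. 1 / (2 * l) * hg_inner E w (\<lambda>x. f x - g x) (\<lambda>x. f x - g x)
                   + hg_Q E w (\<lambda>x. g x / hg_deg E w x))
      in THE g. \<forall>h. F g \<le> F h)"

text \<open>Heat semigroup h_t f = lim_{lambda -> 0+} J_lambda^[t/lambda] f (pointwise limit;
  V is finite so this is the limit in R^V).\<close>
definition hg_heat :: "'v::finite set set \<Rightarrow> ('v set \<Rightarrow> real) \<Rightarrow> real \<Rightarrow> ('v \<Rightarrow> real) \<Rightarrow> 'v \<Rightarrow> real" where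
  "hg_heat E w t f x = Lim (at_right 0) (\<lambda>l. ((hg_resolvent E w l) ^^ nat \<lfloor>t / l\<rfloor>) f x)"

definition hg_Lip1w :: "'v::finite set set \<Rightarrow> ('v set \<Rightarrow> real) \<Rightarrow> ('v \<Rightarrow> real) set" where
  "hg_Lip1w E w = {f. \<forall>x y. \<bar>f x / hg_deg E w x - f y / hg_deg E w y\<bar> \<le> real (hg_dist E x y)}"

definition hg_indicator :: "'v \<Rightarrow> 'v \<Rightarrow> real" where
  "hg_indicator x = (\<lambda>z. if z = x then 1 else 0)"

definition hg_KD :: "'v::finite set set \<Rightarrow> ('v set \<Rightarrow> real) \<Rightarrow> real \<Rightarrow> 'v \<Rightarrow> 'v \<Rightarrow> real" where
  "hg_KD E w l x y = (SUP f\<in>hg_Lip1w E w.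
      hg_inner E w (hg_resolvent E w l f) (\<lambda>z. hg_indicator x z - hg_indicator y z))"

definition hg_kappa :: "'v::finite set set \<Rightarrow> ('v set \<Rightarrow> real) \<Rightarrow> real \<Rightarrow> 'v \<Rightarrow> 'v \<Rightarrow> real" where
  "hg_kappa E w l x y = 1 - hg_KD E w l x y / real (hg_dist E x y)"

definition hg_kappa_bar :: "'v::finite set set \<Rightarrow> ('v set \<Rightarrow> real) \<Rightarrow> 'v \<Rightarrow> 'v \<Rightarrow> ereal" where
  "hg_kappa_bar E w x y = Limsup (at_right 0) (\<lambda>l. ereal (hg_kappa E w l x y / l))"

definition hg_kappa_bar0 :: "'v::finite set set \<Rightarrow> ('v set \<Rightarrow> real) \<Rightarrow> ereal" where
  "hg_kappa_bar0 E w = (INF p\<in>{(x, y). x \<noteq> y}. hg_kappa_bar E w (fst p) (snd p))"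

end

theory Submission
  imports Defs "HOL-Analysis.Analysis"
begin

text \<open>
  The pairs of vertices may attain their upper curvatures along different sequences
  \<open>\<lambda> \<rightarrow> 0\<close>, so the resolvent bounds cannot simply be iterated. Instead, write
  \<open>J\<^sub>\<lambda> f = f - \<lambda> A\<^sub>\<lambda> f\<close>. The Yosida approximations \<open>A\<^sub>\<lambda> f\<close> converge to some \<open>A\<^sub>0 f\<close>, and
  \<open>- A\<^sub>0 f\<close> is the right derivative of the heat flow at \<open>f\<close>. If \<open>f\<close> has
  Lipschitz constant \<open>m\<close> attained at the pair \<open>(x, y)\<close>, then testing \<open>KD\<^sub>\<lambda>(x, y)\<close> with
  \<open>f / m\<close> and letting \<open>\<lambda> \<rightarrow> 0\<close> along a sequence realising the upper limit gives
  \<open>\<langle>A\<^sub>0 f, \<delta>\<^sub>x - \<delta>\<^sub>y\<rangle> \<ge> \<kappa>\<^sub>0 m d(x, y)\<close>. Thus along the flow every maximal slope, multiplied by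
  \<open>e\<^bsup>\<kappa>\<^sub>0 t\<^esup>\<close>, has a nonpositive right derivative, and so the maximum does not increase.
\<close>

section \<open>The flow of a monotone operator with resolvents\<close>

lemma floor_step_bounds:
  fixes l t :: real
  assumes "0 < l" "0 \<le> t"
  shows "real (nat \<lfloor>t / l\<rfloor>) * l \<le> t" "t - l \<le> real (nat \<lfloor>t / l\<rfloor>) * l"
proof -
  have n: "real (nat \<lfloor>t / l\<rfloor>) = of_int \<lfloor>t / l\<rfloor>" using assms by simp
  have "of_int \<lfloor>t / l\<rfloor> \<le> t / l" "t / l - 1 \<le> of_int \<lfloor>t / l\<rfloor>" by linarith+
  then have "of_int \<lfloor>t / l\<rfloor> * l \<le> t / l * l" "(t / l - 1) * l \<le> of_int \<lfloor>t / l\<rfloor> * l"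
    using assms(1) by (intro mult_right_mono; simp)+
  then show "real (nat \<lfloor>t / l\<rfloor>) * l \<le> t" "t - l \<le> real (nat \<lfloor>t / l\<rfloor>) * l"
    unfolding n using assms(1) by (simp_all add: left_diff_distrib)
qed

text \<open>The operator itself never appears: it is represented by its graph points
  \<open>(J l x, (x - J l x) /\<^sub>R l)\<close>. Monotonicity is required across different
  parameters, so that iterates with different step sizes can be compared, and the second assumption
  places every \<open>x\<close> in the domain.\<close>

locale monotone_resolvent =
  fixes J :: "real \<Rightarrow> 'a::{real_inner,complete_space} \<Rightarrow> 'a"
  assumes resolvent_mono: "\<And>l m x y. 0 < l \<Longrightarrow> 0 < m \<Longrightarrow>
      0 \<le> ((x - J l x) /\<^sub>R l - (y - J m y) /\<^sub>R m) \<bullet> (J l x - J m y)"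
    and resolvent_bdd: "\<And>x. \<exists>C. \<forall>l>0. norm ((x - J l x) /\<^sub>R l) \<le> C"
begin

definition yosida :: "real \<Rightarrow> 'a \<Rightarrow> 'a" where
  "yosida l x = (x - J l x) /\<^sub>R l"

definition gen :: "'a \<Rightarrow> 'a" where
  "gen x = Lim (at_right 0) (\<lambda>l. yosida l x)"

definition flow :: "real \<Rightarrow> 'a \<Rightarrow> 'a" where
  "flow t x = Lim (at_right 0) (\<lambda>l. (J l ^^ nat \<lfloor>t / l\<rfloor>) x)"

lemma resolvent_eq_yosida: "0 < l \<Longrightarrow> J l x = x - l *\<^sub>R yosida l x"
  by (simp add: yosida_def)

section \<open>Resolvent steps and their iterates\<close>

text \<open>With \<open>x = p + l *\<^sub>R a\<close> and \<open>y = q + m *\<^sub>R b\<close>, the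
  right side minus the left side is a multiple of the monotonicity product plus nonnegative
  multiples of the squared norms of \<open>a\<close> and \<open>b\<close>.\<close>

lemma resolvent_two_step:
  assumes "0 < l" "0 < m"
  shows "(l + m) * (norm (J l x - J m y))\<^sup>2 \<le> l * (norm (J l x - y))\<^sup>2 + m * (norm (x - J m y))\<^sup>2"
proof -
  define p q a b where "p = J l x" and "q = J m y" and "a = yosida l x" and "b = yosida m y"
  have x: "x = p + l *\<^sub>R a" and y: "y = q + m *\<^sub>R b"
    using assms by (simp_all add: p_def q_def a_def b_def yosida_def)
  have "0 \<le> (a - b) \<bullet> (p - q)"
    using resolvent_mono[OF assms, of x y] by (simp add: p_def q_def a_def b_def yosida_def)
  then have "0 \<le> 2 * (l * m) * ((a - b) \<bullet> (p - q))"
    using assms by simp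
  also have "\<dots> \<le> 2 * (l * m) * ((a - b) \<bullet> (p - q)) + l * (m * m) * (b \<bullet> b) + m * (l * l) * (a \<bullet> a)"
    using assms by simp
  also have "\<dots> = l * ((p - y) \<bullet> (p - y)) + m * ((x - q) \<bullet> (x - q)) - (l + m) * ((p - q) \<bullet> (p - q))"
    unfolding x y by (simp add: inner_add_left inner_add_right inner_diff_left inner_diff_right inner_commute algebra_simps)
  finally show ?thesis
    by (simp add: p_def q_def power2_norm_eq_inner)
qed

lemma resolvent_nonexpansive:
  assumes "0 < l"
  shows "norm (J l x - J l y) \<le> norm (x - y)"
proof -
  define d where "d = J l x - J l y"
  have "0 \<le> l * (((x - J l x) /\<^sub>R l - (y - J l y) /\<^sub>R l) \<bullet> d)"
    unfolding d_def using resolvent_mono[OF assms assms, of x y] assms by simp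
  also have "\<dots> = (x - y) \<bullet> d - d \<bullet> d"
    using assms unfolding scaleR_diff_right[symmetric] inner_scaleR_left
    by (simp add: d_def inner_diff_left mult.assoc[symmetric])
  finally have "norm d * norm d \<le> (x - y) \<bullet> d"
    by (simp add: power2_norm_eq_inner[symmetric] power2_eq_square)
  also have "\<dots> \<le> norm (x - y) * norm d"
    by (rule norm_cauchy_schwarz)
  finally show ?thesis
    unfolding d_def[symmetric]
    by (cases "norm d = 0") (auto simp: mult_le_cancel_right)
qed

lemma iterate_nonexpansive:
  "0 < l \<Longrightarrow> norm ((J l ^^ n) x - (J l ^^ n) y) \<le> norm (x - y)"
proof (induction n)
  case (Suc n)
  then show ?case
    using resolvent_nonexpansive[of l "(J l ^^ n) x" "(J l ^^ n) y"] by simp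
qed simp

text \<open>Nonexpansiveness bounds every step by the first one.\<close>

lemma iterate_step_bound:
  assumes "0 < l" "norm (yosida l x) \<le> C"
  shows "norm ((J l ^^ Suc n) x - (J l ^^ n) x) \<le> l * C"
proof -
  have "norm ((J l ^^ Suc n) x - (J l ^^ n) x) \<le> norm (J l x - x)"
    using iterate_nonexpansive[OF assms(1), of n "J l x" x] by (simp add: funpow_swap1)
  also have "\<dots> = l * norm (yosida l x)"
    using assms(1) by (simp add: resolvent_eq_yosida)
  finally show ?thesis
    using assms by (smt (verit) mult_left_mono)
qed

lemma iterate_dist_start:
  assumes "0 < l" "norm (yosida l x) \<le> C"
  shows "norm ((J l ^^ n) x - x) \<le> n * l * C"
proof (induction n)
  case (Suc n)
  have "norm ((J l ^^ Suc n) x - x) \<le> norm ((J l ^^ Suc n) x - (J l ^^ n) x) + norm ((J l ^^ n) x - x)"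
    using norm_triangle_ineq[of "(J l ^^ Suc n) x - (J l ^^ n) x" "(J l ^^ n) x - x"] by simp
  also have "\<dots> \<le> l * C + n * l * C"
    using Suc iterate_step_bound[OF assms] by (intro add_mono) auto
  finally show ?case
    by (simp add: algebra_simps)
qed simp

text \<open>Kobayashi's estimate; the bound satisfies the recursion of \<open>resolvent_two_step\<close> with equality.\<close>

lemma iterate_dist_iterate:
  assumes "0 < l" "0 < m" and C: "\<And>k. 0 < k \<Longrightarrow> norm (yosida k x) \<le> C"
  shows "(norm ((J l ^^ i) x - (J m ^^ j) x))\<^sup>2 \<le> C\<^sup>2 * ((i * l - j * m)\<^sup>2 + i * l\<^sup>2 + j * m\<^sup>2)"
proof (induction i arbitrary: j)
  case 0
  have "norm (x - (J m ^^ j) x) \<le> j * m * C"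
    using iterate_dist_start[OF assms(2) C[OF assms(2)], of j] by (simp add: norm_minus_commute)
  then have "(norm (x - (J m ^^ j) x))\<^sup>2 \<le> (j * m * C)\<^sup>2"
    by (intro power_mono) auto
  also have "\<dots> \<le> C\<^sup>2 * ((j * m)\<^sup>2 + j * m\<^sup>2)"
    by (simp add: power_mult_distrib algebra_simps)
  finally show ?case by simp
next
  case (Suc i)
  show ?case
  proof (induction j)
    case 0
    have "norm ((J l ^^ Suc i) x - x) \<le> Suc i * l * C"
      using iterate_dist_start[OF assms(1) C[OF assms(1)], of "Suc i"] by simp
    then have "(norm ((J l ^^ Suc i) x - x))\<^sup>2 \<le> (Suc i * l * C)\<^sup>2"
      by (intro power_mono) auto
    also have "\<dots> \<le> C\<^sup>2 * ((Suc i * l)\<^sup>2 + Suc i * l\<^sup>2)"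
      by (simp only: power_mult_distrib distrib_left mult.commute[of _ "C\<^sup>2"]) simp
    finally show ?case by simp
  next
    case (Suc j)
    let ?B = "\<lambda>i j. C\<^sup>2 * ((real i * l - real j * m)\<^sup>2 + real i * l\<^sup>2 + real j * m\<^sup>2)"
    have "(l + m) * (norm ((J l ^^ Suc i) x - (J m ^^ Suc j) x))\<^sup>2
        \<le> l * (norm ((J l ^^ Suc i) x - (J m ^^ j) x))\<^sup>2 + m * (norm ((J l ^^ i) x - (J m ^^ Suc j) x))\<^sup>2"
      using resolvent_two_step[OF assms(1,2), of "(J l ^^ i) x" "(J m ^^ j) x"] by simp
    also have "\<dots> \<le> l * ?B (Suc i) j + m * ?B i (Suc j)"
      \<comment> \<open>\<open>Suc.IH\<close> is the hypothesis of the inner induction on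
        \<open>j\<close>; the quoted fact is that of the outer induction on \<open>i\<close>,
        available for every \<open>j\<close>.\<close>
      using assms Suc.IH Suc.prems \<open>\<And>j. (norm ((J l ^^ i) x - (J m ^^ j) x))\<^sup>2 \<le> ?B i j\<close>
      by (intro add_mono mult_left_mono) (auto simp del: funpow.simps of_nat_Suc)
    also have "\<dots> = (l + m) * ?B (Suc i) (Suc j)"
      by (simp add: power2_eq_square algebra_simps)
    finally show ?case
      using assms by (simp add: mult_le_cancel_left_pos)
  qed
qed

section \<open>Convergence of the Yosida approximations\<close>

text \<open>Monotonicity at one point \<open>x\<close> with two parameters, where
  \<open>J l x - J m x = m *\<^sub>R b - l *\<^sub>R a\<close>. The factor \<open>l + m\<close> is
  weakened to \<open>l - m\<close> so that it cancels. Bounded norms therefore force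
  convergence.\<close>

lemma yosida_cauchy:
  assumes "0 < m" "m < l"
  shows "(norm (yosida m x - yosida l x))\<^sup>2 \<le> (norm (yosida m x))\<^sup>2 - (norm (yosida l x))\<^sup>2"
proof -
  define a b where "a = yosida l x" and "b = yosida m x"
  have l: "0 < l" using assms by simp
  have "0 \<le> (a - b) \<bullet> (m *\<^sub>R b - l *\<^sub>R a)"
    using resolvent_mono[OF l assms(1), of x x] resolvent_eq_yosida[OF l, of x] resolvent_eq_yosida[OF assms(1), of x]
    unfolding yosida_def[symmetric] a_def b_def by (simp add: algebra_simps)
  then have *: "(l + m) * ((b - a) \<bullet> (b - a)) \<le> (l - m) * (b \<bullet> b - a \<bullet> a)"
    by (simp add: inner_diff_left inner_diff_right inner_commute algebra_simps)
  have "(l - m) * ((b - a) \<bullet> (b - a)) \<le> (l + m) * ((b - a) \<bullet> (b - a))"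
    using assms by (intro mult_right_mono) auto
  with * have "(l - m) * ((b - a) \<bullet> (b - a)) \<le> (l - m) * (b \<bullet> b - a \<bullet> a)"
    by linarith
  then show ?thesis
    using assms by (simp add: a_def b_def power2_norm_eq_inner)
qed

lemma yosida_norm_antimono:
  assumes "0 < m" "m \<le> l"
  shows "norm (yosida l x) \<le> norm (yosida m x)"
proof (cases "m = l")
  case False
  then have "(norm (yosida l x))\<^sup>2 \<le> (norm (yosida m x))\<^sup>2"
    using yosida_cauchy[of m l x] assms by (smt (verit) zero_le_power2)
  then show ?thesis by (simp add: power2_le_iff_abs_le)
qed simp

text \<open>Along \<open>l = 1/(n+1)\<close> the squared norms increase and are bounded, so their
  differences, which dominate the squared distances, tend to zero. The limit is then extended to all
  \<open>l\<close> near 0.\<close>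

lemma yosida_convergent:
  "\<exists>v. ((\<lambda>l. yosida l x) \<longlongrightarrow> v) (at_right 0) \<and> (\<forall>l>0. norm (yosida l x) \<le> norm v)"
proof -
  define a where "a n = yosida (inverse (Suc n)) x" for n
  obtain C where C: "\<And>l. 0 < l \<Longrightarrow> norm (yosida l x) \<le> C"
    using resolvent_bdd[of x] by (auto simp: yosida_def)
  have mono: "norm (a i) \<le> norm (a j)" if "i \<le> j" for i j
    unfolding a_def using that by (intro yosida_norm_antimono) (auto intro: le_imp_inverse_le)
  have "incseq (\<lambda>n. (norm (a n))\<^sup>2)"
    by (auto simp: incseq_def intro!: power_mono mono)
  moreover have "(norm (a n))\<^sup>2 \<le> C\<^sup>2" for n
    unfolding a_def by (intro power_mono C) auto
  ultimately obtain L where L: "(\<lambda>n. (norm (a n))\<^sup>2) \<longlonglongrightarrow> L"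
    using incseq_convergent[of "\<lambda>n. (norm (a n))\<^sup>2" "C\<^sup>2"] by blast
  have diff: "(norm (a j - a i))\<^sup>2 \<le> (norm (a j))\<^sup>2 - (norm (a i))\<^sup>2" if "i \<le> j" for i j
  proof (cases "i = j")
    case False
    with that have "inverse (real (Suc j)) < inverse (Suc i)"
      by (intro less_imp_inverse_less) auto
    then show ?thesis unfolding a_def by (intro yosida_cauchy) auto
  qed simp
  have "Cauchy a"
  proof (rule metric_CauchyI)
    fix e :: real assume e: "0 < e"
    then have "0 < e\<^sup>2" by simp
    with L[THEN LIMSEQ_imp_Cauchy] obtain M where
      M: "\<And>i j. M \<le> i \<Longrightarrow> M \<le> j \<Longrightarrow> dist ((norm (a i))\<^sup>2) ((norm (a j))\<^sup>2) < e\<^sup>2"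
      unfolding Cauchy_def by meson
    have *: "dist (a i) (a j) < e" if "M \<le> i" "i \<le> j" for i j
    proof -
      have "(norm (a j - a i))\<^sup>2 < e\<^sup>2"
        using diff[of i j] M[of i j] that by (auto simp: dist_real_def)
      then show ?thesis
        using e power2_less_imp_less[of "norm (a j - a i)" e] by (simp add: dist_norm norm_minus_commute)
    qed
    have "\<forall>i\<ge>M. \<forall>j\<ge>M. dist (a i) (a j) < e"
      using * by (metis dist_commute linear)
    then show "\<exists>M. \<forall>i\<ge>M. \<forall>j\<ge>M. dist (a i) (a j) < e" ..
  qed
  then obtain v where v: "a \<longlonglongrightarrow> v"
    using Cauchy_convergent convergent_def by blast
  \<comment> \<open>The Cauchy estimate with its smaller parameter sent to 0; it yields both the
    norm bound and the convergence for arbitrary \<open>l\<close>.\<close>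
  have v2: "(norm (yosida l x - v))\<^sup>2 \<le> (norm v)\<^sup>2 - (norm (yosida l x))\<^sup>2" if l: "0 < l" for l
  proof (rule LIMSEQ_le)
    show "(\<lambda>n. (norm (yosida l x - a n))\<^sup>2) \<longlonglongrightarrow> (norm (yosida l x - v))\<^sup>2"
      by (intro tendsto_intros v)
    show "(\<lambda>n. (norm (a n))\<^sup>2 - (norm (yosida l x))\<^sup>2) \<longlonglongrightarrow> (norm v)\<^sup>2 - (norm (yosida l x))\<^sup>2"
      by (intro tendsto_intros v)
    obtain N where N: "inverse (real (Suc N)) < l"
      using reals_Archimedean[OF l] by auto
    have "(norm (yosida l x - a n))\<^sup>2 \<le> (norm (a n))\<^sup>2 - (norm (yosida l x))\<^sup>2" if "N \<le> n" for n
    proof -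
      have "inverse (real (Suc n)) \<le> inverse (real (Suc N))"
        using that by (intro le_imp_inverse_le) auto
      with N have "inverse (real (Suc n)) < l" by linarith
      then show ?thesis
        unfolding a_def norm_minus_commute[of "yosida l x"] by (intro yosida_cauchy) auto
    qed
    then show "\<exists>N. \<forall>n\<ge>N. (norm (yosida l x - a n))\<^sup>2 \<le> (norm (a n))\<^sup>2 - (norm (yosida l x))\<^sup>2"
      by blast
  qed
  have bound: "norm (yosida l x) \<le> norm v" if "0 < l" for l
    using v2[OF that] power2_le_imp_le[of "norm (yosida l x)" "norm v"]
    by (smt (verit) norm_ge_zero zero_le_power2)
  have "((\<lambda>l. yosida l x) \<longlongrightarrow> v) (at_right 0)"
  proof (rule tendstoI)
    fix e :: real assume e: "0 < e"
    have "(\<lambda>n. (norm v)\<^sup>2 - (norm (a n))\<^sup>2) \<longlonglongrightarrow> (norm v)\<^sup>2 - (norm v)\<^sup>2"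
      by (intro tendsto_intros v)
    moreover have "(norm v)\<^sup>2 - (norm v)\<^sup>2 < e\<^sup>2" using e by simp
    ultimately have "eventually (\<lambda>n. (norm v)\<^sup>2 - (norm (a n))\<^sup>2 < e\<^sup>2) sequentially"
      by (rule order_tendstoD(2))
    then obtain n where n: "(norm v)\<^sup>2 - (norm (a n))\<^sup>2 < e\<^sup>2"
      by (auto simp: eventually_sequentially)
    have "dist (yosida l x) v < e" if l: "0 < l" "l < inverse (Suc n)" for l
    proof -
      have "(norm (a n))\<^sup>2 \<le> (norm (yosida l x))\<^sup>2"
        unfolding a_def using l by (intro power_mono yosida_norm_antimono) auto
      then have "(norm (yosida l x - v))\<^sup>2 < e\<^sup>2"
        using v2[OF l(1)] n by linarith
      then show ?thesis
        using e power2_less_imp_less[of "norm (yosida l x - v)" e] by (simp add: dist_norm)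
    qed
    then show "eventually (\<lambda>l. dist (yosida l x) v < e) (at_right 0)"
      unfolding eventually_at_right_field by (intro exI[of _ "inverse (Suc n)"]) auto
  qed
  with bound show ?thesis by blast
qed

lemma yosida_tendsto: "((\<lambda>l. yosida l x) \<longlongrightarrow> gen x) (at_right 0)"
  unfolding gen_def using yosida_convergent[of x] tendsto_Lim[OF trivial_limit_at_right_real] by blast

lemma norm_yosida_le: "0 < l \<Longrightarrow> norm (yosida l x) \<le> norm (gen x)"
  using yosida_convergent[of x] tendsto_unique[OF trivial_limit_at_right_real yosida_tendsto[of x]] by blast

section \<open>The exponential formula and the semigroup law\<close>

text \<open>Both discrete times \<open>i * l\<close> and \<open>j * m\<close> lie at most one step
  below \<open>t\<close>, hence differ by at most \<open>l + m\<close> in Kobayashi's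
  estimate.\<close>

lemma iterate_floor_dist:
  assumes "0 < l" "0 < m" "0 \<le> t"
  shows "(norm ((J l ^^ nat \<lfloor>t / l\<rfloor>) x - (J m ^^ nat \<lfloor>t / m\<rfloor>) x))\<^sup>2
    \<le> (norm (gen x))\<^sup>2 * ((l + m)\<^sup>2 + t * l + t * m)"
proof -
  define i j where "i = nat \<lfloor>t / l\<rfloor>" and "j = nat \<lfloor>t / m\<rfloor>"
  have i: "real i * l \<le> t" "t - l \<le> real i * l" and j: "real j * m \<le> t" "t - m \<le> real j * m"
    unfolding i_def j_def using floor_step_bounds assms by blast+
  have "(real i * l - real j * m)\<^sup>2 \<le> (l + m)\<^sup>2"
    using i j assms by (intro power2_le_iff_abs_le[THEN iffD2]) auto
  moreover have "real i * l\<^sup>2 \<le> t * l" "real j * m\<^sup>2 \<le> t * m"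
    using i j assms by (simp_all add: power2_eq_square mult.assoc[symmetric] mult_right_mono)
  ultimately have "(real i * l - real j * m)\<^sup>2 + real i * l\<^sup>2 + real j * m\<^sup>2 \<le> (l + m)\<^sup>2 + t * l + t * m"
    by linarith
  then show ?thesis
    using iterate_dist_iterate[OF assms(1,2) norm_yosida_le, where i = i and j = j]
    unfolding i_def[symmetric] j_def[symmetric]
    by (smt (verit) mult_left_mono zero_le_power2)
qed

text \<open>The Crandall-Liggett limit: the bound \<open>B l m\<close> vanishes as both step sizes
  tend to 0. A limit is found along \<open>1/(n+1)\<close> and then compared with every
  \<open>l\<close>.\<close>

lemma flow_convergent:
  assumes t: "0 \<le> t"
  shows "\<exists>s. ((\<lambda>l. (J l ^^ nat \<lfloor>t / l\<rfloor>) x) \<longlongrightarrow> s) (at_right 0)"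
proof -
  define X where "X l = (J l ^^ nat \<lfloor>t / l\<rfloor>) x" for l
  define r where "r n = inverse (real (Suc n))" for n
  define B where "B l m = (norm (gen x))\<^sup>2 * ((l + m)\<^sup>2 + t * l + t * m)" for l m :: real
  have r: "0 < r n" for n by (simp add: r_def)
  have rlim: "r \<longlonglongrightarrow> 0" unfolding r_def using LIMSEQ_inverse_real_of_nat .
  have XB: "(norm (X l - X m))\<^sup>2 \<le> B l m" if "0 < l" "0 < m" for l m
    unfolding X_def B_def using iterate_floor_dist[OF that t] .
  have "Cauchy (\<lambda>n. X (r n))"
  proof (rule metric_CauchyI)
    fix e :: real assume e: "0 < e"
    have "(\<lambda>n. B (r n) (r n)) \<longlonglongrightarrow> B 0 0"
      unfolding B_def by (intro tendsto_intros rlim)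
    then have "eventually (\<lambda>n. B (r n) (r n) < e\<^sup>2) sequentially"
      using e by (intro order_tendstoD(2)[of _ "B 0 0"]) (auto simp: B_def)
    then obtain M where M: "B (r M) (r M) < e\<^sup>2"
      by (auto simp: eventually_sequentially)
    have "dist (X (r i)) (X (r j)) < e" if "M \<le> i" "M \<le> j" for i j
    proof -
      have "r i \<le> r M" "r j \<le> r M"
        unfolding r_def using that by (intro le_imp_inverse_le; auto)+
      then have "B (r i) (r j) \<le> B (r M) (r M)"
        unfolding B_def using r[of i] r[of j] t
        by (intro mult_left_mono add_mono power_mono) auto
      then have "(norm (X (r i) - X (r j)))\<^sup>2 < e\<^sup>2"
        using XB[OF r r, of i j] M by linarith
      then show ?thesis
        using e power2_less_imp_less[of "norm (X (r i) - X (r j))" e] by (simp add: dist_norm)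
    qed
    then show "\<exists>M. \<forall>i\<ge>M. \<forall>j\<ge>M. dist (X (r i)) (X (r j)) < e" by blast
  qed
  then obtain s where s: "(\<lambda>n. X (r n)) \<longlonglongrightarrow> s"
    using Cauchy_convergent convergent_def by blast
  \<comment> \<open>Sending the second step size to 0 leaves an explicit error bound for step size
    \<open>l\<close>.\<close>
  have sB: "(norm (X l - s))\<^sup>2 \<le> B l 0" if "0 < l" for l
  proof (rule LIMSEQ_le)
    show "(\<lambda>n. (norm (X l - X (r n)))\<^sup>2) \<longlonglongrightarrow> (norm (X l - s))\<^sup>2"
      by (intro tendsto_intros s)
    show "(\<lambda>n. B l (r n)) \<longlonglongrightarrow> B l 0"
      unfolding B_def by (intro tendsto_intros rlim)
    show "\<exists>N. \<forall>n\<ge>N. (norm (X l - X (r n)))\<^sup>2 \<le> B l (r n)"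
      using XB[OF that r] by blast
  qed
  have "((\<lambda>l. norm (X l - s)) \<longlongrightarrow> 0) (at_right 0)"
  proof (rule tendsto_sandwich[where f = "\<lambda>_. 0" and h = "\<lambda>l. sqrt (B l 0)"])
    have "((\<lambda>l. sqrt (B l 0)) \<longlongrightarrow> sqrt (B 0 0)) (at_right 0)"
      unfolding B_def by (intro tendsto_intros)
    then show "((\<lambda>l. sqrt (B l 0)) \<longlongrightarrow> 0) (at_right 0)"
      by (simp add: B_def)
    show "eventually (\<lambda>l. norm (X l - s) \<le> sqrt (B l 0)) (at_right 0)"
      using eventually_at_right_less[of "0::real"] by eventually_elim (intro real_le_rsqrt sB)
  qed auto
  then have "(X \<longlongrightarrow> s) (at_right 0)"
    using Lim_null tendsto_norm_zero_iff by blast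
  then show ?thesis unfolding X_def by blast
qed

lemma flow_tendsto:
  "0 \<le> t \<Longrightarrow> ((\<lambda>l. (J l ^^ nat \<lfloor>t / l\<rfloor>) x) \<longlongrightarrow> flow t x) (at_right 0)"
  unfolding flow_def using flow_convergent[of t x] tendsto_Lim[OF trivial_limit_at_right_real] by blast

lemma flow_0 [simp]: "flow 0 x = x"
  unfolding flow_def by (auto intro!: tendsto_Lim)

lemma flow_dist_start:
  assumes "0 \<le> t"
  shows "norm (flow t x - x) \<le> t * norm (gen x)"
proof (rule tendsto_le[OF trivial_limit_at_right_real tendsto_const tendsto_norm[OF tendsto_diff[OF flow_tendsto[OF assms] tendsto_const]]])
  show "eventually (\<lambda>l. norm ((J l ^^ nat \<lfloor>t / l\<rfloor>) x - x) \<le> t * norm (gen x)) (at_right 0)"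
    using eventually_at_right_less[of "0::real"]
  proof eventually_elim
    case (elim l)
    have "norm ((J l ^^ nat \<lfloor>t / l\<rfloor>) x - x) \<le> real (nat \<lfloor>t / l\<rfloor>) * l * norm (gen x)"
      by (intro iterate_dist_start elim norm_yosida_le)
    also have "\<dots> \<le> t * norm (gen x)"
      using floor_step_bounds(1)[OF elim assms] by (intro mult_right_mono) auto
    finally show ?case .
  qed
qed

text \<open>The step count for \<open>s + t\<close> exceeds the sum of the separate counts by at
  most one. That extra step costs \<open>l * norm (gen x)\<close>, and replacing the inner iterate
  by \<open>flow t x\<close> costs no more than their distance.\<close>

lemma flow_add:
  assumes "0 \<le> s" "0 \<le> t"
  shows "flow (s + t) x = flow s (flow t x)"
proof -
  define N where "N t l = nat \<lfloor>t / l\<rfloor>" for t l :: real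
  let ?y = "flow t x"
  have step: "norm ((J l ^^ N (s + t) l) x - (J l ^^ N s l) ?y) \<le> l * norm (gen x) + norm ((J l ^^ N t l) x - ?y)"
    if l: "0 < l" for l
  proof -
    have "norm ((J l ^^ N (s + t) l) x - (J l ^^ (N s l + N t l)) x) \<le> l * norm (gen x)"
    proof -
      have eq: "(s + t) / l = s / l + t / l" by (simp add: add_divide_distrib)
      have f: "0 \<le> \<lfloor>s / l\<rfloor>" "0 \<le> \<lfloor>t / l\<rfloor>" using assms l by simp_all
      have "\<lfloor>s / l + t / l\<rfloor> = \<lfloor>s / l\<rfloor> + \<lfloor>t / l\<rfloor> \<or> \<lfloor>s / l + t / l\<rfloor> = \<lfloor>s / l\<rfloor> + \<lfloor>t / l\<rfloor> + 1"
        by linarith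
      then have "N (s + t) l = N s l + N t l \<or> N (s + t) l = Suc (N s l + N t l)"
        unfolding N_def eq using f by linarith
      then show ?thesis
        using iterate_step_bound[OF l norm_yosida_le[OF l], where n = "N s l + N t l"] l by auto
    qed
    moreover have "norm ((J l ^^ (N s l + N t l)) x - (J l ^^ N s l) ?y) \<le> norm ((J l ^^ N t l) x - ?y)"
      using iterate_nonexpansive[OF l] by (simp add: funpow_add)
    ultimately show ?thesis
      using norm_triangle_ineq[of "(J l ^^ N (s + t) l) x - (J l ^^ (N s l + N t l)) x" "(J l ^^ (N s l + N t l)) x - (J l ^^ N s l) ?y"]
      by simp
  qed
  have "((\<lambda>l. l * norm (gen x) + norm ((J l ^^ N t l) x - ?y)) \<longlongrightarrow> 0 * norm (gen x) + norm (?y - ?y)) (at_right 0)"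
    unfolding N_def by (intro tendsto_intros flow_tendsto assms)
  then have "norm (flow (s + t) x - flow s ?y) \<le> 0 * norm (gen x) + norm (?y - ?y)"
  proof (rule tendsto_le[OF trivial_limit_at_right_real])
    show "((\<lambda>l. norm ((J l ^^ N (s + t) l) x - (J l ^^ N s l) ?y)) \<longlongrightarrow> norm (flow (s + t) x - flow s ?y)) (at_right 0)"
    unfolding N_def using assms by (intro tendsto_intros flow_tendsto) auto
    show "eventually (\<lambda>l. norm ((J l ^^ N (s + t) l) x - (J l ^^ N s l) ?y)
      \<le> l * norm (gen x) + norm ((J l ^^ N t l) x - ?y)) (at_right 0)"
    using eventually_at_right_less[of "0::real"] by eventually_elim (rule step)
  qed
  then show ?thesis by simp
qed

lemma flow_nonexpansive:
  assumes "0 \<le> t"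
  shows "norm (flow t x - flow t y) \<le> norm (x - y)"
proof (rule tendsto_le[OF trivial_limit_at_right_real tendsto_const tendsto_norm[OF tendsto_diff[OF flow_tendsto[OF assms] flow_tendsto[OF assms]]]])
  show "eventually (\<lambda>l. norm ((J l ^^ nat \<lfloor>t / l\<rfloor>) x - (J l ^^ nat \<lfloor>t / l\<rfloor>) y) \<le> norm (x - y)) (at_right 0)"
    using eventually_at_right_less[of "0::real"] by eventually_elim (rule iterate_nonexpansive)
qed

text \<open>The semigroup law and nonexpansiveness move the shorter time to 0, where
  \<open>flow_dist_start\<close> applies.\<close>

lemma flow_lipschitz:
  assumes "0 \<le> s" "0 \<le> t"
  shows "norm (flow s x - flow t x) \<le> \<bar>s - t\<bar> * norm (gen x)"
proof -
  have *: "norm (flow s x - flow t x) \<le> (t - s) * norm (gen x)" if "0 \<le> s" "s \<le> t" for s t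
  proof -
    have "flow t x = flow s (flow (t - s) x)"
      using flow_add[of s "t - s" x] that by simp
    then have "norm (flow s x - flow t x) \<le> norm (flow (t - s) x - x)"
      using flow_nonexpansive[OF that(1), of "flow (t - s) x" x] by (simp add: norm_minus_commute)
    also have "\<dots> \<le> (t - s) * norm (gen x)"
      using that by (intro flow_dist_start) simp
    finally show ?thesis .
  qed
  show ?thesis
    using *[of s t] *[of t s] assms by (cases "s \<le> t") (auto simp: norm_minus_commute)
qed

lemma continuous_on_flow: "continuous_on {0..} (\<lambda>t. flow t x)"
proof (rule lipschitz_on_continuous_on)
  show "(norm (gen x))-lipschitz_on {0..} (\<lambda>t. flow t x)"
    using flow_lipschitz[of _ _ x] by (intro lipschitz_onI) (auto simp: dist_norm mult.commute)
qed

section \<open>Right derivative of the flow\<close>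

text \<open>Testing monotonicity along the implicit Euler scheme against the graph point
  \<open>(J m x, yosida m x)\<close> makes the difference quotients of the flow converge without
  identifying \<open>gen x\<close> as the element of minimal norm of the operator.\<close>

lemma iterate_energy:
  assumes "0 < l" "0 < m" "n * l \<le> h"
  shows "(norm ((J l ^^ n) x - J m x))\<^sup>2 - (norm (x - J m x))\<^sup>2
    \<le> 2 * (n * l) * (h * norm (yosida m x) * norm (gen x) - m * (norm (yosida m x))\<^sup>2)"
  using assms(3)
proof (induction n)
  case (Suc n)
  define b z y q where "b = yosida m x" and "z = J m x" and "y = (J l ^^ n) x" and "q = J l y"
  have "0 \<le> ((y - q) /\<^sub>R l - b) \<bullet> (q - z)"
    using resolvent_mono[OF assms(1,2), of y x] by (simp add: b_def z_def q_def yosida_def)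
  then have "0 \<le> l * (((y - q) /\<^sub>R l - b) \<bullet> (q - z))"
    using assms(1) by simp
  also have "\<dots> = (y - q) \<bullet> (q - z) - l * (b \<bullet> (q - z))"
    using assms(1) by (simp add: inner_diff_left[of _ b] right_diff_distrib)
  finally have 1: "l * (b \<bullet> (q - z)) \<le> (y - q) \<bullet> (q - z)" by simp
  have "(norm (y - z))\<^sup>2 - (norm (q - z))\<^sup>2 - 2 * ((y - q) \<bullet> (q - z)) = (norm (y - q))\<^sup>2"
    unfolding power2_norm_eq_inner
    by (simp add: inner_diff_left inner_diff_right inner_commute algebra_simps)
  then have 2: "(norm (q - z))\<^sup>2 - (norm (y - z))\<^sup>2 \<le> - 2 * ((y - q) \<bullet> (q - z))"
    by (smt (verit) zero_le_power2)
  \<comment> \<open>Since \<open>q\<close> stays within \<open>h * norm (gen x)\<close> of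
    \<open>x\<close>, the product \<open>b \<bullet> (q - z)\<close> equals
    \<open>b \<bullet> (x - z) = m * (norm b)\<^sup>2\<close> up to an error of order
    \<open>h\<close>.\<close>
  have "norm (q - x) \<le> Suc n * l * norm (gen x)"
    using iterate_dist_start[OF assms(1) norm_yosida_le[OF assms(1)], of "Suc n" x] by (simp add: q_def y_def)
  also have "\<dots> \<le> h * norm (gen x)"
    using Suc.prems by (intro mult_right_mono) auto
  finally have q: "norm (q - x) \<le> h * norm (gen x)" .
  have "- (b \<bullet> (q - x)) \<le> norm b * norm (q - x)"
    using norm_cauchy_schwarz[of "-b" "q - x"] by simp
  also have "\<dots> \<le> norm b * (h * norm (gen x))"
    by (intro mult_left_mono q) auto
  finally have "- (b \<bullet> (q - x)) \<le> h * norm b * norm (gen x)" by (simp add: mult_ac)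
  moreover have "b \<bullet> (q - z) = b \<bullet> (q - x) + m * (norm b)\<^sup>2"
    using resolvent_eq_yosida[OF assms(2), of x]
    by (simp add: z_def b_def inner_diff_right power2_norm_eq_inner)
  ultimately have "- (b \<bullet> (q - z)) \<le> h * norm b * norm (gen x) - m * (norm b)\<^sup>2" by linarith
  then have "2 * l * (- (b \<bullet> (q - z))) \<le> 2 * l * (h * norm b * norm (gen x) - m * (norm b)\<^sup>2)"
    using assms(1) by (intro mult_left_mono) auto
  with 1 2 have "(norm (q - z))\<^sup>2 - (norm (y - z))\<^sup>2 \<le> 2 * l * (h * norm b * norm (gen x) - m * (norm b)\<^sup>2)"
    by linarith
  moreover have "real n * l \<le> h" using Suc.prems assms(1) by (simp add: algebra_simps)
  ultimately show ?case
    using Suc.IH by (simp add: b_def z_def y_def q_def algebra_simps)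
qed simp

text \<open>The limit \<open>l \<rightarrow> 0\<close> of the energy estimate bounds
  \<open>q \<bullet> b\<close> below by \<open>b \<bullet> b\<close> minus an error of order
  \<open>h / m\<close>. Together with \<open>norm q \<le> norm (gen x)\<close> this controls the
  expanded square of \<open>q - b\<close>.\<close>

lemma flow_quotient_near_yosida:
  assumes "0 < h" "0 < m"
  shows "(norm ((x - flow h x) /\<^sub>R h - yosida m x))\<^sup>2
    \<le> (norm (gen x))\<^sup>2 - (norm (yosida m x))\<^sup>2 + 2 * (h / m) * (norm (gen x))\<^sup>2"
proof -
  define b q where "b = yosida m x" and "q = (x - flow h x) /\<^sub>R h"
  have S: "flow h x = x - h *\<^sub>R q" using assms by (simp add: q_def)
  have z: "J m x = x - m *\<^sub>R b" using resolvent_eq_yosida assms by (simp add: b_def)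
  have "(norm (flow h x - J m x))\<^sup>2 - (norm (x - J m x))\<^sup>2
      \<le> 2 * h * (h * norm b * norm (gen x) - m * (norm b)\<^sup>2)"
  proof (rule tendsto_le[OF trivial_limit_at_right_real])
    let ?N = "\<lambda>l. nat \<lfloor>h / l\<rfloor>"
    show "((\<lambda>l. (norm ((J l ^^ ?N l) x - J m x))\<^sup>2 - (norm (x - J m x))\<^sup>2)
        \<longlongrightarrow> (norm (flow h x - J m x))\<^sup>2 - (norm (x - J m x))\<^sup>2) (at_right 0)"
      using assms by (intro tendsto_intros flow_tendsto) auto
    have "((\<lambda>l. real (?N l) * l) \<longlongrightarrow> h) (at_right 0)"
    proof (rule tendsto_sandwich)
      show "eventually (\<lambda>l. h - l \<le> real (?N l) * l) (at_right 0)"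
        using eventually_at_right_less[of "0::real"] by eventually_elim (use assms floor_step_bounds in auto)
      show "eventually (\<lambda>l. real (?N l) * l \<le> h) (at_right 0)"
        using eventually_at_right_less[of "0::real"] by eventually_elim (use assms floor_step_bounds in auto)
      have "((\<lambda>l. h - l) \<longlongrightarrow> h - 0) (at_right 0)" by (intro tendsto_intros)
      then show "((\<lambda>l. h - l) \<longlongrightarrow> h) (at_right 0)" by simp
    qed simp
    then show "((\<lambda>l. 2 * (real (?N l) * l) * (h * norm b * norm (gen x) - m * (norm b)\<^sup>2))
        \<longlongrightarrow> 2 * h * (h * norm b * norm (gen x) - m * (norm b)\<^sup>2)) (at_right 0)"
      by (intro tendsto_intros)
    show "eventually (\<lambda>l. (norm ((J l ^^ ?N l) x - J m x))\<^sup>2 - (norm (x - J m x))\<^sup>2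
        \<le> 2 * (real (?N l) * l) * (h * norm b * norm (gen x) - m * (norm b)\<^sup>2)) (at_right 0)"
      using eventually_at_right_less[of "0::real"] unfolding b_def
      by eventually_elim (use assms floor_step_bounds in \<open>intro iterate_energy; simp\<close>)
  qed
  then have "(2 * h) * (h / 2 * (q \<bullet> q) - m * (q \<bullet> b)) \<le> (2 * h) * (h * norm b * norm (gen x) - m * (b \<bullet> b))"
    unfolding S z power2_norm_eq_inner
    by (simp add: inner_diff_left inner_diff_right inner_commute algebra_simps)
  then have "h / 2 * (q \<bullet> q) - m * (q \<bullet> b) \<le> h * norm b * norm (gen x) - m * (b \<bullet> b)"
    using assms by (simp only: mult_le_cancel_left_pos[of "2 * h"]) 
  moreover have "0 \<le> h / 2 * (q \<bullet> q)" using assms by simp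
  moreover have "h * norm b * norm (gen x) \<le> h * (norm (gen x))\<^sup>2"
    using norm_yosida_le[OF assms(2), of x] assms unfolding b_def power2_eq_square mult.assoc
    by (intro mult_left_mono mult_right_mono) auto
  ultimately have "m * (b \<bullet> b - q \<bullet> b) \<le> h * (norm (gen x))\<^sup>2"
    by (simp add: algebra_simps)
  then have 1: "b \<bullet> b - q \<bullet> b \<le> h / m * (norm (gen x))\<^sup>2"
    using assms by (simp add: field_simps)
  have "norm q = norm (flow h x - x) / h"
    using assms by (simp add: q_def norm_minus_commute divide_inverse mult.commute)
  then have "norm q \<le> norm (gen x)"
    using flow_dist_start[of h x] assms by (simp add: pos_divide_le_eq mult.commute)
  then have "q \<bullet> q \<le> (norm (gen x))\<^sup>2"
    unfolding power2_norm_eq_inner[symmetric] by (intro power_mono) auto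
  with 1 have "(q - b) \<bullet> (q - b) \<le> (norm (gen x))\<^sup>2 - b \<bullet> b + 2 * (h / m * (norm (gen x))\<^sup>2)"
    by (simp add: inner_diff_left inner_diff_right inner_commute)
  then show ?thesis
    unfolding b_def q_def power2_norm_eq_inner by simp
qed

text \<open>The order of choices matters: first \<open>m\<close>, making \<open>yosida m x\<close>
  close to \<open>gen x\<close> in position and in norm, then \<open>h\<close> small relative to
  \<open>m\<close>.\<close>

lemma flow_right_derivative_0:
  "((\<lambda>h. (x - flow h x) /\<^sub>R h) \<longlongrightarrow> gen x) (at_right 0)"
proof (rule tendstoI)
  fix e :: real assume e: "0 < e"
  have "((\<lambda>m. norm (yosida m x - gen x)) \<longlongrightarrow> norm (gen x - gen x)) (at_right 0)"
    by (intro tendsto_intros yosida_tendsto)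
  then have 1: "eventually (\<lambda>m. norm (yosida m x - gen x) < e / 2) (at_right 0)"
    using e by (intro order_tendstoD(2)) auto
  have "((\<lambda>m. (norm (gen x))\<^sup>2 - (norm (yosida m x))\<^sup>2) \<longlongrightarrow> (norm (gen x))\<^sup>2 - (norm (gen x))\<^sup>2) (at_right 0)"
    by (intro tendsto_intros yosida_tendsto)
  then have 2: "eventually (\<lambda>m. (norm (gen x))\<^sup>2 - (norm (yosida m x))\<^sup>2 < (e / 2)\<^sup>2) (at_right 0)"
    using e by (intro order_tendstoD(2)) auto
  have "eventually (\<lambda>m. 0 < m \<and> norm (yosida m x - gen x) < e / 2
      \<and> (norm (gen x))\<^sup>2 - (norm (yosida m x))\<^sup>2 < (e / 2)\<^sup>2) (at_right 0)"
    using 1 2 eventually_at_right_less[of "0::real"] by eventually_elim auto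
  then obtain m where m: "0 < m" "norm (yosida m x - gen x) < e / 2"
    "(norm (gen x))\<^sup>2 - (norm (yosida m x))\<^sup>2 < (e / 2)\<^sup>2"
    using eventually_happens'[OF trivial_limit_at_right_real] by blast
  have "((\<lambda>h. (norm (gen x))\<^sup>2 - (norm (yosida m x))\<^sup>2 + 2 * (h / m) * (norm (gen x))\<^sup>2)
      \<longlongrightarrow> (norm (gen x))\<^sup>2 - (norm (yosida m x))\<^sup>2 + 2 * (0 / m) * (norm (gen x))\<^sup>2) (at_right 0)"
    using m(1) by (intro tendsto_intros) auto
  then have "eventually (\<lambda>h. (norm (gen x))\<^sup>2 - (norm (yosida m x))\<^sup>2 + 2 * (h / m) * (norm (gen x))\<^sup>2 < (e / 2)\<^sup>2) (at_right 0)"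
    using m(3) by (intro order_tendstoD(2)) auto
  then show "eventually (\<lambda>h. dist ((x - flow h x) /\<^sub>R h) (gen x) < e) (at_right 0)"
    using eventually_at_right_less[of "0::real"]
  proof eventually_elim
    case (elim h)
    have "(norm ((x - flow h x) /\<^sub>R h - yosida m x))\<^sup>2 < (e / 2)\<^sup>2"
      using flow_quotient_near_yosida[OF elim(2) m(1), of x] elim(1) by linarith
    then have "norm ((x - flow h x) /\<^sub>R h - yosida m x) < e / 2"
      using e by (intro power2_less_imp_less[of _ "e / 2"]) auto
    then show ?case
      using m(2) norm_triangle_ineq[of "(x - flow h x) /\<^sub>R h - yosida m x" "yosida m x - gen x"]
      by (simp add: dist_norm)
  qed
qed

end

section \<open>A comparison principle for finitely many functions\<close>

text \<open>Barrier argument with \<open>c + e * t\<close>. At the infimum \<open>T\<close> of the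
  crossing times, a function touching the barrier is positive and maximal, so its right derivative
  is below the slope \<open>e\<close>; the others stay below by continuity. No crossing can then
  follow immediately after \<open>T\<close>.\<close>

lemma running_max_bound:
  fixes G :: "'p \<Rightarrow> real \<Rightarrow> real"
  assumes fin: "finite P" and c: "0 < c"
    and cont: "\<And>p. p \<in> P \<Longrightarrow> continuous_on {0..} (G p)"
    and init: "\<And>p. p \<in> P \<Longrightarrow> G p 0 \<le> c"
    and deriv: "\<And>p T. p \<in> P \<Longrightarrow> 0 \<le> T \<Longrightarrow> 0 < G p T \<Longrightarrow> (\<And>q. q \<in> P \<Longrightarrow> G q T \<le> G p T)
      \<Longrightarrow> \<exists>D\<le>0. (G p has_real_derivative D) (at_right T)"
    and "p \<in> P" "0 \<le> t"
  shows "G p t \<le> c"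
proof -
  have main: "G p t \<le> c + e * t" if e: "0 < e" and pt: "p \<in> P" "0 \<le> t" for e p t
  proof (rule ccontr)
    assume bad: "\<not> G p t \<le> c + e * t"
    define B where "B = {t. 0 \<le> t \<and> (\<exists>p\<in>P. c + e * t < G p t)}"
    define T where "T = Inf B"
    have "t \<in> B" using bad pt unfolding B_def by (simp add: not_le) blast
    then have ne: "B \<noteq> {}" by blast
    have bdd: "bdd_below B" by (auto simp: B_def intro: bdd_belowI[of _ 0])
    have T0: "0 \<le> T"
      unfolding T_def using ne by (intro cInf_greatest) (auto simp: B_def)
    have Tle: "T \<le> s" if "s \<in> B" for s
      unfolding T_def using bdd that by (rule cInf_lower[rotated])
    have good: "G q T \<le> c + e * T" if q: "q \<in> P" for q
    proof (rule ccontr)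
      assume "\<not> G q T \<le> c + e * T"
      then have pos: "0 < G q T - c - e * T" by simp
      then have Tpos: "0 < T" using init[OF q] T0 by (cases "T = 0") auto
      have "continuous_on {0..} (\<lambda>s. G q s - c - e * s)"
        by (intro continuous_intros cont q)
      then have "\<exists>d>0. \<forall>s\<in>{0..}. dist s T < d \<longrightarrow> dist (G q s - c - e * s) (G q T - c - e * T) < G q T - c - e * T"
        unfolding continuous_on_iff using T0 pos by (simp only: atLeast_iff)
      then obtain d where d: "0 < d"
        "\<And>s. 0 \<le> s \<Longrightarrow> dist s T < d \<Longrightarrow> dist (G q s - c - e * s) (G q T - c - e * T) < G q T - c - e * T"
        by auto
      \<comment> \<open>A time strictly before \<open>T\<close>, close enough for the violation to
        persist, and truncated at 0 to stay in the domain.\<close>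
      define s where "s = max 0 (T - d / 2)"
      have s: "0 \<le> s" "s < T" "dist s T < d"
        using d(1) Tpos by (auto simp: s_def dist_real_def)
      have "0 < G q s - c - e * s"
        using d(2)[OF s(1,3)] by (auto simp: dist_real_def)
      then have "c + e * s < G q s" by simp
      then have "s \<in> B" using q s by (auto simp: B_def)
      with Tle s show False by force
    qed
    have "eventually (\<lambda>s. G q s \<le> c + e * s) (at_right T)" if q: "q \<in> P" for q
    proof (cases "G q T < c + e * T")
      case True
      have "continuous_on {0..} (\<lambda>s. G q s - e * s)"
        by (intro continuous_intros cont q)
      then have "((\<lambda>s. G q s - e * s) \<longlongrightarrow> G q T - e * T) (at T within {0..})"
        using T0 by (auto simp: continuous_on_def)
      then have "((\<lambda>s. G q s - e * s) \<longlongrightarrow> G q T - e * T) (at_right T)"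
        by (rule tendsto_within_subset) (use T0 in auto)
      then have "eventually (\<lambda>s. G q s - e * s < c) (at_right T)"
        using True by (intro order_tendstoD(2)) auto
      then show ?thesis by eventually_elim auto
    next
      case False
      with good[OF q] have eq: "G q T = c + e * T" by simp
      have "0 < G q T" unfolding eq using c e T0 by (simp add: add_pos_nonneg)
      then obtain D where D: "D \<le> 0" "(G q has_real_derivative D) (at_right T)"
        using deriv[OF q T0] good eq by force
      have "((\<lambda>s. (G q s - G q T) / (s - T)) \<longlongrightarrow> D) (at_right T)"
        using D(2) by (simp add: has_field_derivative_iff)
      then have "eventually (\<lambda>s. (G q s - G q T) / (s - T) < e) (at_right T)"
        using D(1) e by (intro order_tendstoD(2)[of _ D]) auto
      then show ?thesis
        using eventually_at_right_less[of T]
        by eventually_elim (auto simp: pos_divide_less_eq eq algebra_simps)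
    qed
    then have "eventually (\<lambda>s. \<forall>q\<in>P. G q s \<le> c + e * s) (at_right T)"
      using fin by (intro eventually_ball_finite) auto
    then obtain b where b: "T < b" "\<And>s q. T < s \<Longrightarrow> s < b \<Longrightarrow> q \<in> P \<Longrightarrow> G q s \<le> c + e * s"
      unfolding eventually_at_right_field by blast
    \<comment> \<open>No crossing occurs at \<open>T\<close> itself, so crossing times must
      accumulate at \<open>T\<close> from the right.\<close>
    obtain s where s: "s \<in> B" "s < b"
      using cInf_lessD[OF ne, of b] b(1) unfolding T_def by blast
    have "s \<noteq> T" using good s(1) by (force simp: B_def)
    with Tle[OF s(1)] b(2)[of s] s show False by (force simp: B_def)
  qed
  have "G p t \<le> c + e" if "0 < e" for e
  proof -
    \<comment> \<open>Dividing by \<open>t + 1\<close> instead of \<open>t\<close> covers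
      \<open>t = 0\<close> as well.\<close>
    have "G p t \<le> c + (e / (t + 1)) * t"
      using that assms by (intro main) auto
    also have "\<dots> \<le> c + e" using that assms(7) by (simp add: field_simps)
    finally show ?thesis .
  qed
  then show ?thesis by (rule field_le_epsilon)
qed

section \<open>Proximal minimisers of convex functions\<close>

definition prox_energy :: "('a::euclidean_space \<Rightarrow> real) \<Rightarrow> real \<Rightarrow> 'a \<Rightarrow> 'a \<Rightarrow> real" where
  "prox_energy \<Phi> l x g = 1 / (2 * l) * (norm (x - g))\<^sup>2 + \<Phi> g"

text \<open>Outside the ball of radius \<open>r\<close> the quadratic term alone is at least
  \<open>\<Phi> x\<close>, the energy of the centre, so minimising over the compact ball
  suffices.\<close>

lemma prox_minimizer_exists:
  fixes \<Phi> :: "'a::euclidean_space \<Rightarrow> real"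
  assumes "convex_on UNIV \<Phi>" and nonneg: "\<And>x. 0 \<le> \<Phi> x" and l: "0 < l"
  shows "\<exists>g. \<forall>h. prox_energy \<Phi> l x g \<le> prox_energy \<Phi> l x h"
proof -
  define r where "r = sqrt (2 * l * \<Phi> x)"
  have "continuous_on UNIV \<Phi>"
    using convex_on_continuous[OF open_UNIV assms(1)] .
  then have "continuous_on UNIV (prox_energy \<Phi> l x)"
    unfolding prox_energy_def[abs_def] by (intro continuous_intros)
  then have "continuous_on (cball x r) (prox_energy \<Phi> l x)"
    by (rule continuous_on_subset) simp
  moreover have r: "0 \<le> r" using l nonneg by (simp add: r_def)
  moreover have "cball x r \<noteq> {}" using r by simp
  ultimately obtain g where g: "\<And>h. h \<in> cball x r \<Longrightarrow> prox_energy \<Phi> l x g \<le> prox_energy \<Phi> l x h"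
    using continuous_attains_inf[OF compact_cball, of x r "prox_energy \<Phi> l x"] by blast
  have "prox_energy \<Phi> l x g \<le> prox_energy \<Phi> l x h" for h
  proof (cases "h \<in> cball x r")
    case False
    then have "r\<^sup>2 \<le> (norm (x - h))\<^sup>2"
      using r by (intro power_mono) (auto simp: dist_norm)
    then have "2 * l * \<Phi> x \<le> (norm (x - h))\<^sup>2"
      using l nonneg by (simp add: r_def)
    then have "\<Phi> x \<le> 1 / (2 * l) * (norm (x - h))\<^sup>2"
      using l by (simp add: field_simps)
    then have "prox_energy \<Phi> l x x \<le> prox_energy \<Phi> l x h"
      using nonneg[of h] by (simp add: prox_energy_def)
    then show ?thesis using g[of x] r by force
  qed (rule g)
  then show ?thesis by blast
qed

text \<open>First-order optimality without derivatives: compare \<open>g\<close> with the convex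
  combination \<open>(1 - s) *\<^sub>R g + s *\<^sub>R h\<close>, divide by \<open>s\<close>, and
  let \<open>s \<rightarrow> 0\<close>.\<close>

lemma prox_minimizer_subgradient:
  fixes \<Phi> :: "'a::euclidean_space \<Rightarrow> real"
  assumes conv: "convex_on UNIV \<Phi>" and l: "0 < l"
    and min: "\<And>h. prox_energy \<Phi> l x g \<le> prox_energy \<Phi> l x h"
  shows "\<Phi> g + ((x - g) /\<^sub>R l) \<bullet> (h - g) \<le> \<Phi> h"
proof -
  define I N c where "I = (x - g) \<bullet> (h - g)" and "N = (norm (h - g))\<^sup>2" and "c = 1 / (2 * l)"
  have I: "((x - g) /\<^sub>R l) \<bullet> (h - g) = 2 * c * I"
    by (simp add: I_def c_def inverse_eq_divide)
  have *: "2 * c * I - (\<Phi> h - \<Phi> g) \<le> s * (c * N)" if s: "0 < s" "s < 1" for s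
  proof -
    define y where "y = (1 - s) *\<^sub>R g + s *\<^sub>R h"
    have y: "x - y = (x - g) - s *\<^sub>R (h - g)"
      by (simp add: y_def algebra_simps)
    have eq: "(norm (x - y))\<^sup>2 = (norm (x - g))\<^sup>2 - 2 * s * I + s * s * N"
      unfolding y I_def N_def power2_norm_eq_inner
        inner_diff_left[of _ "s *\<^sub>R (h - g)"] inner_diff_right[of _ _ "s *\<^sub>R (h - g)"]
      by (simp add: inner_commute[of "h - g" "x - g"])
    have "\<Phi> y \<le> (1 - s) * \<Phi> g + s * \<Phi> h"
      unfolding y_def using convex_onD[OF conv, of s g h] s by simp
    moreover have "c * (norm (x - g))\<^sup>2 + \<Phi> g \<le> c * ((norm (x - g))\<^sup>2 - 2 * s * I + s * s * N) + \<Phi> y"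
      using min[of y] unfolding prox_energy_def eq c_def .
    ultimately have "s * (2 * c * I - (\<Phi> h - \<Phi> g)) \<le> s * (s * (c * N))"
      by (simp add: algebra_simps)
    then show ?thesis
      using s(1) by (rule mult_left_le_imp_le)
  qed
  have "((\<lambda>s. s * (c * N)) \<longlongrightarrow> 0 * (c * N)) (at_right 0)"
    by (intro tendsto_intros)
  then have "2 * c * I - (\<Phi> h - \<Phi> g) \<le> 0 * (c * N)"
  proof (rule tendsto_lowerbound)
    show "eventually (\<lambda>s. 2 * c * I - (\<Phi> h - \<Phi> g) \<le> s * (c * N)) (at_right 0)"
      by (rule eventually_at_rightI[of 0 1], rule *) auto
  qed simp
  then show ?thesis unfolding I by simp
qed

text \<open>Adding the subgradient inequalities of the two minimisers, each tested at the other,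
  leaves a nonpositive multiple of their squared distance.\<close>

lemma prox_minimizer_unique:
  fixes \<Phi> :: "'a::euclidean_space \<Rightarrow> real"
  assumes conv: "convex_on UNIV \<Phi>" and l: "0 < l"
    and g: "\<And>h. prox_energy \<Phi> l x g \<le> prox_energy \<Phi> l x h"
    and g': "\<And>h. prox_energy \<Phi> l x g' \<le> prox_energy \<Phi> l x h"
  shows "g = g'"
proof -
  have "((x - g) /\<^sub>R l) \<bullet> (g' - g) + ((x - g') /\<^sub>R l) \<bullet> (g - g') \<le> 0"
    using prox_minimizer_subgradient[OF conv l g, of g'] prox_minimizer_subgradient[OF conv l g', of g] by linarith
  also have "((x - g) /\<^sub>R l) \<bullet> (g' - g) + ((x - g') /\<^sub>R l) \<bullet> (g - g') = inverse l * ((g - g') \<bullet> (g - g'))"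
    by (simp add: inner_diff_left inner_diff_right inner_commute algebra_simps)
  finally have "(g - g') \<bullet> (g - g') \<le> 0"
    using l by (simp add: mult_le_0_iff)
  moreover have "0 \<le> (g - g') \<bullet> (g - g')" by simp
  ultimately have "(g - g') \<bullet> (g - g') = 0" by linarith
  then show ?thesis by simp
qed

lemma subgradient_norm_bound:
  fixes a :: "'a::real_inner"
  assumes "0 < l" "\<Phi> g + a \<bullet> (x - g) \<le> \<Phi> x" "x - g = l *\<^sub>R a" "\<Phi> x - \<Phi> g \<le> L * norm (x - g)" "0 \<le> L"
  shows "norm a \<le> L"
proof -
  have "a \<bullet> (x - g) \<le> L * norm (x - g)" using assms by linarith
  then have "l * norm a * norm a \<le> l * norm a * L"
    using assms by (simp add: power2_norm_eq_inner[symmetric] power2_eq_square mult_ac)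
  then show ?thesis
    using assms by (cases "a = 0") auto
qed

text \<open>Two subgradient inequalities add up to monotonicity, whatever the parameters. The
  constant \<open>L x\<close> may depend on \<open>x\<close>, which accommodates functionals of
  quadratic growth.\<close>

lemma monotone_resolvent_subgradient:
  fixes J :: "real \<Rightarrow> 'a::{real_inner,complete_space} \<Rightarrow> 'a"
  assumes sub: "\<And>l x h. 0 < l \<Longrightarrow> \<Phi> (J l x) + ((x - J l x) /\<^sub>R l) \<bullet> (h - J l x) \<le> \<Phi> h"
    and lip: "\<And>x y. \<Phi> x - \<Phi> y \<le> L x * norm (x - y)" and L: "\<And>x. 0 \<le> L x"
  shows "monotone_resolvent J"
proof
  fix l m :: real and x y :: 'a
  assume "0 < l" "0 < m"
  then show "0 \<le> ((x - J l x) /\<^sub>R l - (y - J m y) /\<^sub>R m) \<bullet> (J l x - J m y)"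
    using sub[of l x "J m y"] sub[of m y "J l x"]
    by (simp add: inner_diff_left inner_diff_right algebra_simps)
next
  fix x
  have "norm ((x - J l x) /\<^sub>R l) \<le> L x" if "0 < l" for l
    using subgradient_norm_bound[OF that sub[OF that, of x x] _ lip[of x "J l x"] L[of x]] that by auto
  then show "\<exists>C. \<forall>l>0. norm ((x - J l x) /\<^sub>R l) \<le> C" by blast
qed

section \<open>The hypergraph heat flow\<close>

definition osc :: "'v set \<Rightarrow> ('v \<Rightarrow> real) \<Rightarrow> real" where
  "osc e u = Max {u x - u y | x y. x \<in> e \<and> y \<in> e}"

lemma finite_differences:
  fixes e :: "'v::finite set" and u :: "'v \<Rightarrow> real"
  shows "finite {u x - u y | x y. x \<in> e \<and> y \<in> e}"
  by (rule finite_subset[of _ "(\<lambda>(x, y). u x - u y) ` UNIV"]) auto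

lemma osc_upper:
  fixes e :: "'v::finite set"
  assumes "x \<in> e" "y \<in> e"
  shows "u x - u y \<le> osc e u"
  unfolding osc_def using assms by (intro Max_ge finite_differences) auto

lemma osc_least:
  fixes e :: "'v::finite set"
  assumes "e \<noteq> {}" "\<And>x y. x \<in> e \<Longrightarrow> y \<in> e \<Longrightarrow> u x - u y \<le> c"
  shows "osc e u \<le> c"
proof -
  obtain z where "z \<in> e" using assms(1) by blast
  then have "u z - u z \<in> {u x - u y | x y. x \<in> e \<and> y \<in> e}" by blast
  then show ?thesis
    unfolding osc_def using assms(2) by (intro Max.boundedI finite_differences) auto
qed

lemma osc_nonneg:
  fixes e :: "'v::finite set"
  shows "e \<noteq> {} \<Longrightarrow> 0 \<le> osc e u"
  using osc_upper[of _ e _ u] by (metis diff_self ex_in_conv)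

lemma osc_add_le:
  fixes e :: "'v::finite set"
  assumes "e \<noteq> {}"
  shows "osc e (\<lambda>x. u x + v x) \<le> osc e u + osc e v"
  using assms
proof (rule osc_least)
  fix x y assume "x \<in> e" "y \<in> e"
  then show "u x + v x - (u y + v y) \<le> osc e u + osc e v"
    using osc_upper[of x e y u] osc_upper[of x e y v] by linarith
qed

lemma osc_scale_le:
  fixes e :: "'v::finite set"
  assumes "e \<noteq> {}" "0 \<le> c"
  shows "osc e (\<lambda>x. c * u x) \<le> c * osc e u"
  using assms(1)
proof (rule osc_least)
  fix x y assume "x \<in> e" "y \<in> e"
  then show "c * u x - c * u y \<le> c * osc e u"
    using mult_left_mono[OF osc_upper[of x e y u] assms(2)] by (simp add: algebra_simps)
qed

text \<open>The reverse inequality is \<open>osc_scale_le\<close> applied with factor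
  \<open>inverse c\<close>.\<close>

lemma osc_scale:
  fixes e :: "'v::finite set"
  assumes "e \<noteq> {}" "0 < c"
  shows "osc e (\<lambda>x. c * u x) = c * osc e u"
proof (rule antisym)
  have "osc e (\<lambda>x. inverse c * (c * u x)) \<le> inverse c * osc e (\<lambda>x. c * u x)"
    using assms by (intro osc_scale_le) auto
  then show "c * osc e u \<le> osc e (\<lambda>x. c * u x)"
    using assms by (simp add: field_simps)
qed (use assms in \<open>simp add: osc_scale_le\<close>)

lemma hg_Q_osc: "hg_Q E w u = 1 / 2 * (\<Sum>e\<in>E. w e * (osc e u)\<^sup>2)"
  by (simp add: hg_Q_def osc_def)

section \<open>Hypergraph distance\<close>

lemma relpowp_sym:
  assumes "\<And>x y. R x y \<Longrightarrow> R y x"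
  shows "(R ^^ n) x y \<Longrightarrow> (R ^^ n) y x"
proof (induction n arbitrary: x y)
  case (Suc n)
  then obtain z where "(R ^^ n) x z" "R z y" by auto
  then show ?case using Suc.IH assms by (meson relpowp_Suc_I2)
qed simp

lemma hg_dist_commute: "hg_dist E x y = hg_dist E y x"
proof -
  have "(hg_adj E ^^ n) x y = (hg_adj E ^^ n) y x" for n x y
    using relpowp_sym[of "hg_adj E" n] by (auto simp: hg_adj_def)
  then show ?thesis by (simp add: hg_dist_def)
qed

locale weighted_hg =
  fixes E :: "'v::finite set set" and w :: "'v set \<Rightarrow> real"
  assumes wh: "weighted_hypergraph E w"
begin

abbreviation "deg \<equiv> hg_deg E w"

lemma deg_pos [simp]: "0 < deg x" and edge_nonempty: "e \<in> E \<Longrightarrow> e \<noteq> {}"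
  and weight_pos: "e \<in> E \<Longrightarrow> 0 < w e"
  using wh by (auto simp: weighted_hypergraph_def)

lemma deg_simps [simp]: "0 \<le> deg x" "deg x \<noteq> 0"
  using deg_pos[of x] by linarith+

lemma hg_dist_pos:
  assumes "x \<noteq> y"
  shows "0 < hg_dist E x y"
proof -
  obtain n where "(hg_adj E ^^ n) x y"
    using wh unfolding weighted_hypergraph_def hg_connected_def by blast
  then have "(hg_adj E ^^ hg_dist E x y) x y"
    unfolding hg_dist_def by (rule LeastI)
  then show ?thesis using assms by (cases "hg_dist E x y") auto
qed

lemma hg_dist_edge: "e \<in> E \<Longrightarrow> x \<in> e \<Longrightarrow> y \<in> e \<Longrightarrow> hg_dist E x y \<le> 1"
  unfolding hg_dist_def by (rule Least_le) (subst relpowp_1, auto simp: hg_adj_def)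

text \<open>The isometry \<open>to_vec\<close> turns \<open>hg_inner\<close> into the standard inner product of \<open>real ^ 'v\<close>.\<close>

definition to_vec :: "('v \<Rightarrow> real) \<Rightarrow> real ^ 'v" where
  "to_vec f = (\<chi> x. f x / sqrt (deg x))"

definition of_vec :: "real ^ 'v \<Rightarrow> 'v \<Rightarrow> real" where
  "of_vec v = (\<lambda>x. v $ x * sqrt (deg x))"

text \<open>For \<open>v = to_vec f\<close> this is \<open>f x / deg x\<close>, the function to
  which \<open>hg_Q\<close> and the weighted Lipschitz condition refer.\<close>

definition pot :: "real ^ 'v \<Rightarrow> 'v \<Rightarrow> real" where
  "pot v = (\<lambda>x. v $ x / sqrt (deg x))"

definition slope :: "real ^ 'v \<Rightarrow> 'v \<Rightarrow> 'v \<Rightarrow> real" where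
  "slope v x y = pot v x - pot v y"

definition dirichlet :: "real ^ 'v \<Rightarrow> real" where
  "dirichlet v = hg_Q E w (pot v)"

definition resolvent :: "real \<Rightarrow> real ^ 'v \<Rightarrow> real ^ 'v" where
  "resolvent l v = to_vec (hg_resolvent E w l (of_vec v))"

definition embed_const :: real where
  "embed_const = 2 * (\<Sum>x\<in>UNIV. 1 / sqrt (deg x))"

text \<open>A bound for the subgradients of \<open>dirichlet\<close> at \<open>v\<close>: each
  squared oscillation over 2 changes at rate \<open>osc\<close>, and oscillations change by at most
  \<open>embed_const\<close> times the norm.\<close>

definition dirichlet_lip :: "real ^ 'v \<Rightarrow> real" where
  "dirichlet_lip v = embed_const * (\<Sum>e\<in>E. w e * osc e (pot v))"

lemma of_vec_to_vec [simp]: "of_vec (to_vec f) = f"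
  by (auto simp: of_vec_def to_vec_def)

lemma to_vec_of_vec [simp]: "to_vec (of_vec v) = v"
  by (auto simp: of_vec_def to_vec_def vec_eq_iff)

lemma pot_to_vec: "pot (to_vec f) x = f x / deg x"
  by (simp add: pot_def to_vec_def)

lemma of_vec_div_deg: "of_vec v x / deg x = pot v x"
  by (metis pot_to_vec to_vec_of_vec)

lemma pot_add: "pot (u + v) x = pot u x + pot v x"
  and pot_diff: "pot (u - v) x = pot u x - pot v x"
  and pot_scale: "pot (c *\<^sub>R v) x = c * pot v x"
  by (simp_all add: pot_def add_divide_distrib diff_divide_distrib)

lemma slope_diff: "slope (u - v) x y = slope u x y - slope v x y"
  and slope_scale: "slope (c *\<^sub>R v) x y = c * slope v x y"
  by (simp_all add: slope_def pot_diff pot_scale algebra_simps)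

lemma tendsto_slope: "(f \<longlongrightarrow> v) F \<Longrightarrow> ((\<lambda>t. slope (f t) x y) \<longlongrightarrow> slope v x y) F"
  unfolding slope_def pot_def by (intro tendsto_intros) auto

lemma embed_const_nonneg: "0 \<le> embed_const"
  by (simp add: embed_const_def sum_nonneg)

lemma slope_le_norm: "\<bar>slope v x y\<bar> \<le> embed_const * norm v"
proof -
  let ?S = "\<Sum>x\<in>UNIV. 1 / sqrt (deg x)"
  have *: "\<bar>pot v x\<bar> \<le> ?S * norm v" for x
  proof -
    have "\<bar>pot v x\<bar> = 1 / sqrt (deg x) * \<bar>v $ x\<bar>"
      by (simp add: pot_def)
    also have "\<dots> \<le> ?S * norm v"
      by (intro mult_mono component_le_norm_cart sum_nonneg member_le_sum) auto
    finally show ?thesis .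
  qed
  show ?thesis
    using *[of x] *[of y] unfolding slope_def embed_const_def by (simp add: abs_le_iff)
qed

lemma osc_pot_le: "e \<in> E \<Longrightarrow> osc e (pot v) \<le> embed_const * norm v"
  using slope_le_norm[of v] by (intro osc_least edge_nonempty) (auto simp: slope_def abs_le_iff)

lemma hg_inner_diff: "hg_inner E w (\<lambda>x. f x - g x) (\<lambda>x. f x - g x) = (norm (to_vec f - to_vec g))\<^sup>2"
proof -
  have "(norm (to_vec f - to_vec g))\<^sup>2 = (\<Sum>x\<in>UNIV. ((f x - g x) / sqrt (deg x)) * ((f x - g x) / sqrt (deg x)))"
    by (simp add: power2_norm_eq_inner inner_vec_def to_vec_def diff_divide_distrib)
  also have "\<dots> = hg_inner E w (\<lambda>x. f x - g x) (\<lambda>x. f x - g x)"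
    unfolding hg_inner_def by (intro sum.cong) auto
  finally show ?thesis ..
qed

text \<open>Pairing with the difference of indicators reads off a slope, so \<open>hg_KD\<close> is
  a supremum of slopes of resolvents.\<close>

lemma hg_inner_indicator:
  "hg_inner E w f (\<lambda>z. hg_indicator x z - hg_indicator y z) = slope (to_vec f) x y"
proof -
  have "hg_inner E w f (\<lambda>z. hg_indicator x z - hg_indicator y z)
      = (\<Sum>z\<in>UNIV. (if z = x then f z / deg z else 0) - (if z = y then f z / deg z else 0))"
    unfolding hg_inner_def hg_indicator_def
    by (intro sum.cong) (auto simp: algebra_simps diff_divide_distrib)
  then show ?thesis by (simp add: slope_def pot_to_vec sum_subtractf)
qed

section \<open>The Dirichlet energy\<close>

lemma dirichlet_osc: "dirichlet v = (\<Sum>e\<in>E. w e * ((osc e (pot v))\<^sup>2 / 2))"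
  by (simp add: dirichlet_def hg_Q_osc sum_distrib_left)

lemma dirichlet_nonneg: "0 \<le> dirichlet v"
  unfolding dirichlet_osc by (intro sum_nonneg mult_nonneg_nonneg less_imp_le[OF weight_pos]) auto

lemma dirichlet_scale: "0 < c \<Longrightarrow> dirichlet (c *\<^sub>R v) = c\<^sup>2 * dirichlet v"
proof -
  assume c: "0 < c"
  have "pot (c *\<^sub>R v) = (\<lambda>x. c * pot v x)" by (auto simp: pot_scale)
  then show ?thesis
    unfolding dirichlet_osc sum_distrib_left using c edge_nonempty
    by (intro sum.cong) (auto simp: osc_scale power_mult_distrib)
qed

text \<open>Each oscillation is sublinear and nonnegative, so its square is convex; the defect is
  the term \<open>t * (1 - t) * (a - b)\<^sup>2\<close>.\<close>

lemma dirichlet_convex: "convex_on UNIV dirichlet"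
proof (rule convex_onI)
  fix t :: real and u v :: "real ^ 'v"
  assume t: "0 < t" "t < 1"
  let ?z = "(1 - t) *\<^sub>R u + t *\<^sub>R v"
  have "w e * ((osc e (pot ?z))\<^sup>2 / 2) \<le> (1 - t) * (w e * ((osc e (pot u))\<^sup>2 / 2)) + t * (w e * ((osc e (pot v))\<^sup>2 / 2))"
    if e: "e \<in> E" for e
  proof -
    define a b where "a = osc e (pot u)" and "b = osc e (pot v)"
    note ne = edge_nonempty[OF e]
    have "pot ?z = (\<lambda>x. (1 - t) * pot u x + t * pot v x)"
      by (auto simp: pot_add pot_scale)
    then have "osc e (pot ?z) \<le> osc e (\<lambda>x. (1 - t) * pot u x) + osc e (\<lambda>x. t * pot v x)"
      using osc_add_le[OF ne] by simp
    also have "\<dots> = (1 - t) * a + t * b"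
      using t by (simp add: osc_scale[OF ne] a_def b_def)
    finally have "(osc e (pot ?z))\<^sup>2 \<le> ((1 - t) * a + t * b)\<^sup>2"
      by (intro power_mono osc_nonneg ne)
    also have "\<dots> = (1 - t) * a\<^sup>2 + t * b\<^sup>2 - t * (1 - t) * (a - b)\<^sup>2"
      by (simp add: power2_eq_square algebra_simps)
    also have "\<dots> \<le> (1 - t) * a\<^sup>2 + t * b\<^sup>2"
      using t by simp
    finally have "w e * ((osc e (pot ?z))\<^sup>2 / 2) \<le> w e * (((1 - t) * a\<^sup>2 + t * b\<^sup>2) / 2)"
      using weight_pos[OF e] by (intro mult_left_mono divide_right_mono) auto
    also have "\<dots> = (1 - t) * (w e * (a\<^sup>2 / 2)) + t * (w e * (b\<^sup>2 / 2))"
      by (simp only: add_divide_distrib distrib_left) (simp add: mult_ac)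
    finally show ?thesis by (simp only: a_def b_def)
  qed
  then show "dirichlet ?z \<le> (1 - t) * dirichlet u + t * dirichlet v"
    unfolding dirichlet_osc sum_distrib_left sum.distrib[symmetric] by (rule sum_mono)
qed simp

lemma dirichlet_lip_nonneg: "0 \<le> dirichlet_lip v"
  unfolding dirichlet_lip_def
  by (intro mult_nonneg_nonneg sum_nonneg embed_const_nonneg osc_nonneg edge_nonempty less_imp_le[OF weight_pos])

text \<open>Edgewise, \<open>a \<le> b + c\<close> gives
  \<open>a\<^sup>2 - b\<^sup>2 \<le> 2 * a * c\<close>, so the constant depends on \<open>u\<close>
  only.\<close>

lemma dirichlet_lipschitz: "dirichlet u - dirichlet v \<le> dirichlet_lip u * norm (u - v)"
proof -
  have "w e * ((osc e (pot u))\<^sup>2 / 2) - w e * ((osc e (pot v))\<^sup>2 / 2)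
      \<le> w e * osc e (pot u) * (embed_const * norm (u - v))" if e: "e \<in> E" for e
  proof -
    define a b c where "a = osc e (pot u)" and "b = osc e (pot v)" and "c = osc e (pot (u - v))"
    note ne = edge_nonempty[OF e]
    have nn: "0 \<le> a" "0 \<le> b" "0 \<le> c" unfolding a_def b_def c_def by (intro osc_nonneg ne)+
    have "pot u = (\<lambda>x. pot v x + pot (u - v) x)" by (auto simp: pot_diff)
    then have abc: "a \<le> b + c" using osc_add_le[OF ne, of "pot v" "pot (u - v)"] by (simp add: a_def b_def c_def)
    have "a\<^sup>2 - b\<^sup>2 \<le> 2 * a * c"
    proof (cases "a \<le> b")
      case True
      then have "a\<^sup>2 \<le> b\<^sup>2" using nn by (intro power_mono)
      moreover have "0 \<le> 2 * a * c" using nn by simp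
      ultimately show ?thesis by linarith
    next
      case False
      have "a\<^sup>2 - b\<^sup>2 = (a + b) * (a - b)" by (simp add: power2_eq_square algebra_simps)
      also have "\<dots> \<le> (2 * a) * c" using False nn abc by (intro mult_mono) auto
      finally show ?thesis .
    qed
    also have "\<dots> \<le> 2 * a * (embed_const * norm (u - v))"
      unfolding c_def using nn by (intro mult_left_mono osc_pot_le e) auto
    finally have "w e / 2 * (a\<^sup>2 - b\<^sup>2) \<le> w e / 2 * (2 * a * (embed_const * norm (u - v)))"
      using weight_pos[OF e] by (intro mult_left_mono) auto
    then show ?thesis by (simp add: a_def b_def algebra_simps)
  qed
  then have "(\<Sum>e\<in>E. w e * ((osc e (pot u))\<^sup>2 / 2) - w e * ((osc e (pot v))\<^sup>2 / 2))
      \<le> (\<Sum>e\<in>E. w e * osc e (pot u) * (embed_const * norm (u - v)))"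
    by (rule sum_mono)
  then show ?thesis
    unfolding dirichlet_osc dirichlet_lip_def sum_subtractf sum_distrib_right[symmetric] by (simp add: mult_ac)
qed

section \<open>The resolvent as a proximal map\<close>

text \<open>The description in \<open>hg_resolvent\<close> denotes a minimiser once existence and
  uniqueness are known; both are carried over from \<open>real ^ 'v\<close> by the bijection
  \<open>to_vec\<close>.\<close>

lemma resolvent_minimizes:
  assumes l: "0 < l"
  shows "prox_energy dirichlet l v (resolvent l v) \<le> prox_energy dirichlet l v h"
proof -
  define F where "F g = 1 / (2 * l) * hg_inner E w (\<lambda>x. of_vec v x - g x) (\<lambda>x. of_vec v x - g x)
                   + hg_Q E w (\<lambda>x. g x / hg_deg E w x)" for g
  have F: "F g = prox_energy dirichlet l v (to_vec g)" for g
  proof -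
    have "pot (to_vec g) = (\<lambda>x. g x / deg x)" by (auto simp: pot_to_vec)
    then show ?thesis by (simp add: F_def prox_energy_def dirichlet_def hg_inner_diff)
  qed
  obtain g where g: "\<And>h. prox_energy dirichlet l v g \<le> prox_energy dirichlet l v h"
    using prox_minimizer_exists[OF dirichlet_convex dirichlet_nonneg l] by blast
  have "(THE g. \<forall>h. F g \<le> F h) = of_vec g"
  proof (rule the_equality)
    show "\<forall>h. F (of_vec g) \<le> F h" by (simp add: F g)
    fix g' assume g': "\<forall>h. F g' \<le> F h"
    have "prox_energy dirichlet l v (to_vec g') \<le> prox_energy dirichlet l v h" for h
      using g'[rule_format, of "of_vec h"] by (simp add: F)
    then have "to_vec g' = g"
      using prox_minimizer_unique[OF dirichlet_convex l _ g] by blast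
    then show "g' = of_vec g" by (metis of_vec_to_vec)
  qed
  moreover have "(THE g. \<forall>h. F g \<le> F h) = hg_resolvent E w l (of_vec v)"
    unfolding hg_resolvent_def F_def Let_def ..
  ultimately show ?thesis using g by (simp add: resolvent_def)
qed

lemma resolvent_subgradient:
  "0 < l \<Longrightarrow> dirichlet (resolvent l v) + ((v - resolvent l v) /\<^sub>R l) \<bullet> (h - resolvent l v) \<le> dirichlet h"
  using prox_minimizer_subgradient[OF dirichlet_convex _ resolvent_minimizes] by blast

sublocale monotone_resolvent resolvent
  using monotone_resolvent_subgradient[OF resolvent_subgradient dirichlet_lipschitz dirichlet_lip_nonneg] .

text \<open>An explicit bound, needed to make the estimate uniform over all weighted 1-Lipschitz
  functions.\<close>

lemma norm_yosida_le_dirichlet_lip: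
  assumes l: "0 < l"
  shows "norm (yosida l v) \<le> dirichlet_lip v"
  unfolding yosida_def using l
  by (intro subgradient_norm_bound[OF l resolvent_subgradient[OF l, of v v] _
        dirichlet_lipschitz[of v "resolvent l v"] dirichlet_lip_nonneg]) auto

text \<open>Both terms of the proximal energy are homogeneous of degree 2, so minimisers scale. This
  lets \<open>hg_KD\<close>, which only sees Lipschitz constant 1, be applied to any positive
  constant.\<close>

lemma resolvent_scale:
  assumes c: "0 < c" and l: "0 < l"
  shows "resolvent l (c *\<^sub>R v) = c *\<^sub>R resolvent l v"
proof -
  have *: "prox_energy dirichlet l (c *\<^sub>R v) (c *\<^sub>R g) = c\<^sup>2 * prox_energy dirichlet l v g" for g
    using c unfolding prox_energy_def scaleR_diff_right[symmetric] norm_scaleR power_mult_distrib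
    by (simp add: dirichlet_scale distrib_left)
  have "prox_energy dirichlet l (c *\<^sub>R v) (c *\<^sub>R resolvent l v) \<le> prox_energy dirichlet l (c *\<^sub>R v) h" for h
  proof -
    have "c\<^sup>2 * prox_energy dirichlet l v (resolvent l v) \<le> c\<^sup>2 * prox_energy dirichlet l v (h /\<^sub>R c)"
      by (intro mult_left_mono resolvent_minimizes l) auto
    then show ?thesis using c *[of "h /\<^sub>R c"] by (simp add: *)
  qed
  then show ?thesis
    using prox_minimizer_unique[OF dirichlet_convex l resolvent_minimizes[OF l]] by blast
qed

lemma yosida_scale: "0 < c \<Longrightarrow> 0 < l \<Longrightarrow> yosida l (c *\<^sub>R v) = c *\<^sub>R yosida l v"
  by (simp add: yosida_def resolvent_scale scaleR_diff_right mult.commute)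

lemma gen_scale:
  assumes "0 < c"
  shows "gen (c *\<^sub>R v) = c *\<^sub>R gen v"
proof (rule tendsto_unique[OF trivial_limit_at_right_real yosida_tendsto])
  have "((\<lambda>l. c *\<^sub>R yosida l v) \<longlongrightarrow> c *\<^sub>R gen v) (at_right 0)"
    by (intro tendsto_intros yosida_tendsto)
  moreover have "eventually (\<lambda>l. c *\<^sub>R yosida l v = yosida l (c *\<^sub>R v)) (at_right 0)"
    using eventually_at_right_less[of "0::real"] by eventually_elim (simp add: yosida_scale assms)
  ultimately show "((\<lambda>l. yosida l (c *\<^sub>R v)) \<longlongrightarrow> c *\<^sub>R gen v) (at_right 0)"
    by (rule Lim_transform_eventually)
qed

section \<open>From curvature to slopes of the generator\<close>

lemma hg_Lip1w_iff: "f \<in> hg_Lip1w E w \<longleftrightarrow> (\<forall>x y. slope (to_vec f) x y \<le> hg_dist E x y)"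
proof -
  have "slope (to_vec f) x y = - slope (to_vec f) y x" for x y by (simp add: slope_def)
  then have "(\<forall>x y. \<bar>slope (to_vec f) x y\<bar> \<le> hg_dist E x y) \<longleftrightarrow> (\<forall>x y. slope (to_vec f) x y \<le> hg_dist E x y)"
    by (metis abs_le_iff hg_dist_commute)
  then show ?thesis by (simp add: hg_Lip1w_def slope_def pot_to_vec)
qed

text \<open>Vertices sharing an edge are at distance at most 1, so every edge oscillation is at most
  1.\<close>

lemma dirichlet_lip_Lip1w:
  assumes "f \<in> hg_Lip1w E w"
  shows "dirichlet_lip (to_vec f) \<le> embed_const * (\<Sum>e\<in>E. w e)"
proof -
  have "osc e (pot (to_vec f)) \<le> 1" if e: "e \<in> E" for e
  proof (rule osc_least[OF edge_nonempty[OF e]])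
    fix x y assume "x \<in> e" "y \<in> e"
    then have "real (hg_dist E x y) \<le> 1" using hg_dist_edge[OF e] by simp
    then show "pot (to_vec f) x - pot (to_vec f) y \<le> 1"
      using assms unfolding hg_Lip1w_iff slope_def by (meson order_trans)
  qed
  then have "(\<Sum>e\<in>E. w e * osc e (pot (to_vec f))) \<le> (\<Sum>e\<in>E. w e * 1)"
    by (intro sum_mono mult_left_mono less_imp_le[OF weight_pos]) auto
  then show ?thesis
    unfolding dirichlet_lip_def using embed_const_nonneg by (simp add: mult_left_mono)
qed

text \<open>A real \<open>SUP\<close> dominates its family only if the family is bounded above.
  Boundedness follows from writing the resolvent as \<open>v - l *\<^sub>R yosida l v\<close> with
  uniformly bounded \<open>yosida l v\<close>.\<close>

lemma slope_resolvent_le_KD: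
  assumes l: "0 < l" and f: "f \<in> hg_Lip1w E w"
  shows "slope (resolvent l (to_vec f)) x y \<le> hg_KD E w l x y"
proof -
  have eq: "hg_inner E w (hg_resolvent E w l f) (\<lambda>z. hg_indicator x z - hg_indicator y z)
      = slope (resolvent l (to_vec f)) x y" for f
    by (simp add: hg_inner_indicator resolvent_def)
  have "slope (resolvent l (to_vec f)) x y \<le> hg_dist E x y + l * (embed_const * (embed_const * (\<Sum>e\<in>E. w e)))"
    if f: "f \<in> hg_Lip1w E w" for f
  proof -
    let ?a = "yosida l (to_vec f)"
    have "- slope ?a x y \<le> embed_const * norm ?a"
      using slope_le_norm[of ?a x y] by (simp add: abs_le_iff)
    also have "\<dots> \<le> embed_const * (embed_const * (\<Sum>e\<in>E. w e))"
      using norm_yosida_le_dirichlet_lip[OF l] dirichlet_lip_Lip1w[OF f]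
      by (intro mult_left_mono embed_const_nonneg) (meson order_trans)
    finally have "l * (- slope ?a x y) \<le> l * (embed_const * (embed_const * (\<Sum>e\<in>E. w e)))"
      using l by (intro mult_left_mono) auto
    moreover have "slope (to_vec f) x y \<le> hg_dist E x y" using f by (simp add: hg_Lip1w_iff)
    ultimately show ?thesis
      by (simp add: resolvent_eq_yosida[OF l] slope_diff slope_scale)
  qed
  then show ?thesis
    unfolding hg_KD_def eq using f by (intro cSUP_upper bdd_aboveI2) auto
qed

text \<open>Testing \<open>hg_KD\<close> with \<open>v\<close>, whose slope at \<open>(x, y)\<close>
  is extremal, bounds \<open>hg_kappa / l\<close> by the slope of \<open>yosida l v\<close> divided
  by the distance.\<close>

lemma gen_slope_ge_unit:
  assumes xy: "x \<noteq> y" and k: "ereal k \<le> hg_kappa_bar0 E w"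
    and lip: "\<And>a b. slope v a b \<le> hg_dist E a b" and tight: "slope v x y = hg_dist E x y"
  shows "k * hg_dist E x y \<le> slope (gen v) x y"
proof -
  let ?d = "real (hg_dist E x y)"
  have d: "0 < ?d" using hg_dist_pos[OF xy] by simp
  have f: "of_vec v \<in> hg_Lip1w E w" using lip by (simp add: hg_Lip1w_iff)
  have "hg_kappa E w l x y / l \<le> slope (yosida l v) x y / ?d" if l: "0 < l" for l
  proof -
    have "?d - l * slope (yosida l v) x y \<le> hg_KD E w l x y"
      using slope_resolvent_le_KD[OF l f, of x y]
      by (simp add: resolvent_eq_yosida[OF l] slope_diff slope_scale tight)
    then have "1 - hg_KD E w l x y / ?d \<le> l * (slope (yosida l v) x y / ?d)"
      using divide_right_mono[of "?d - l * slope (yosida l v) x y" "hg_KD E w l x y" ?d] d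
      by (simp add: diff_divide_distrib)
    then show ?thesis
      using l by (simp add: hg_kappa_def pos_divide_le_eq mult.commute)
  qed
  then have "eventually (\<lambda>l. ereal (hg_kappa E w l x y / l) \<le> ereal (slope (yosida l v) x y / ?d)) (at_right 0)"
    using eventually_at_right_less[of "0::real"] by (auto elim: eventually_mono)
  then have "hg_kappa_bar E w x y \<le> Limsup (at_right 0) (\<lambda>l. ereal (slope (yosida l v) x y / ?d))"
    unfolding hg_kappa_bar_def by (rule Limsup_mono)
  \<comment> \<open>The Yosida slopes converge, so only the curvature side needs an upper
    limit.\<close>
  also have "\<dots> = ereal (slope (gen v) x y / ?d)"
    using d by (intro lim_imp_Limsup) (auto intro!: tendsto_intros tendsto_slope yosida_tendsto)
  finally have "hg_kappa_bar E w x y \<le> ereal (slope (gen v) x y / ?d)" .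
  moreover have "hg_kappa_bar0 E w \<le> hg_kappa_bar E w x y"
    unfolding hg_kappa_bar0_def using xy by (intro INF_lower2[of "(x, y)"]) auto
  ultimately have "ereal k \<le> ereal (slope (gen v) x y / ?d)"
    using k by (meson order_trans)
  then show ?thesis using d by (simp add: field_simps)
qed

lemma gen_slope_ge:
  fixes m :: real
  assumes xy: "x \<noteq> y" and k: "ereal k \<le> hg_kappa_bar0 E w" and m: "0 < m"
    and lip: "\<And>a b. slope v a b \<le> m * hg_dist E a b" and tight: "slope v x y = m * hg_dist E x y"
  shows "k * slope v x y \<le> slope (gen v) x y"
proof -
  \<comment> \<open>Rescaling by \<open>m\<close> makes the Lipschitz constant 1; the conclusion is
    homogeneous of degree 1.\<close>
  have "k * hg_dist E x y \<le> slope (gen (v /\<^sub>R m)) x y"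
    using m lip tight by (intro gen_slope_ge_unit xy k) (auto simp: slope_scale field_simps)
  also have "\<dots> = slope (gen v) x y / m"
    using m by (simp add: gen_scale slope_scale inverse_eq_divide)
  finally show ?thesis using m tight by (simp add: field_simps)
qed

section \<open>Decay of slopes along the heat flow\<close>

text \<open>The semigroup law restarts the flow at \<open>flow T v\<close>, reducing the claim to
  the derivative at time 0.\<close>

lemma slope_flow_right_derivative:
  assumes T: "0 \<le> T"
  shows "((\<lambda>t. slope (flow t v) x y) has_real_derivative - slope (gen (flow T v)) x y) (at_right T)"
proof -
  define g where "g = flow T v"
  have "((\<lambda>h. - slope ((g - flow h g) /\<^sub>R h) x y) \<longlongrightarrow> - slope (gen g) x y) (at_right 0)"
    by (intro tendsto_intros tendsto_slope flow_right_derivative_0)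
  moreover have "eventually (\<lambda>h. - slope ((g - flow h g) /\<^sub>R h) x y
      = (slope (flow (h + T) v) x y - slope (flow T v) x y) / (h + T - T)) (at_right 0)"
    using eventually_at_right_less[of "0::real"]
  proof eventually_elim
    case (elim h)
    then show ?case
      using T flow_add[of h T v] by (simp add: g_def slope_scale slope_diff field_simps)
  qed
  ultimately have "((\<lambda>h. (slope (flow (h + T) v) x y - slope (flow T v) x y) / (h + T - T)) \<longlongrightarrow> - slope (gen g) x y) (at_right 0)"
    by (rule Lim_transform_eventually)
  then show ?thesis
    unfolding has_field_derivative_iff filterlim_at_right_to_0[of _ _ T] g_def by simp
qed

text \<open>The comparison principle is applied to the slopes normalised by distance and multiplied
  by \<open>exp (k * t)\<close>; \<open>gen_slope_ge\<close> supplies the sign of the right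
  derivative at a maximal pair.\<close>

lemma slope_flow_decay:
  assumes k: "ereal k \<le> hg_kappa_bar0 E w" and xy: "x \<noteq> y" and t: "0 \<le> t"
    and lip: "\<And>a b. slope v a b \<le> hg_dist E a b"
  shows "slope (flow t v) x y \<le> exp (- k * t) * hg_dist E x y"
proof -
  define G where "G = (\<lambda>(a, b) t. exp (k * t) * slope (flow t v) a b / hg_dist E a b)"
  let ?P = "{(a, b). a \<noteq> b} :: ('v \<times> 'v) set"
  have "G (x, y) t \<le> 1"
  proof (rule running_max_bound[where P = ?P and G = G and c = 1])
    fix p :: "'v \<times> 'v" assume p: "p \<in> ?P"
    obtain a b where ab: "p = (a, b)" "a \<noteq> b" using p by auto
    have d: "0 < real (hg_dist E a b)" using hg_dist_pos[OF ab(2)] by simp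
    have "continuous_on {0..} (\<lambda>t. slope (flow t v) a b)"
      using continuous_on_flow[of v] unfolding continuous_on_def by (auto intro: tendsto_slope)
    then show "continuous_on {0..} (G p)"
      unfolding G_def ab using d by (auto intro!: continuous_intros)
    show "G p 0 \<le> 1"
      unfolding G_def ab using d lip[of a b] by simp
    fix T :: real
    assume T: "0 \<le> T" and pos: "0 < G p T" and max: "\<And>q. q \<in> ?P \<Longrightarrow> G q T \<le> G p T"
    let ?g = "flow T v"
    \<comment> \<open>The exponential factor is common to all pairs, so a pair maximising
      \<open>G\<close> at \<open>T\<close> realises the Lipschitz constant \<open>m\<close> of
      \<open>flow T v\<close>; positivity of \<open>G p T\<close> gives
      \<open>m > 0\<close>.\<close>
    define m where "m = slope ?g a b / hg_dist E a b"
    have m: "0 < m" "slope ?g a b = m * hg_dist E a b"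
      using pos d by (auto simp: m_def G_def ab zero_less_divide_iff zero_less_mult_iff)
    have "slope ?g a' b' \<le> m * hg_dist E a' b'" for a' b'
    proof (cases "a' = b'")
      case True
      then show ?thesis using m by (simp add: slope_def)
    next
      case False
      have "slope ?g a' b' / hg_dist E a' b' \<le> m"
        using max[of "(a', b')"] False by (simp add: G_def ab m_def flip: times_divide_eq_right)
      then show ?thesis using hg_dist_pos[OF False] by (simp add: pos_divide_le_eq)
    qed
    then have key: "k * slope ?g a b \<le> slope (gen ?g) a b"
      using gen_slope_ge[OF ab(2) k m(1) _ m(2)] by blast
    \<comment> \<open>Written in the shape delivered by the product rule; the sign is read off after
      factoring out the exponential.\<close>
    define D where "D = (exp (k * T) * k * slope ?g a b + - slope (gen ?g) a b * exp (k * T)) / hg_dist E a b"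
    have "D = exp (k * T) * (k * slope ?g a b - slope (gen ?g) a b) / hg_dist E a b"
      by (simp add: D_def algebra_simps)
    then have "D \<le> 0"
      using key d by (simp add: divide_nonpos_pos mult_nonneg_nonpos)
    moreover have "((\<lambda>t. exp (k * t)) has_real_derivative exp (k * T) * k) (at_right T)"
      by (auto intro!: derivative_eq_intros)
    then have "(G p has_real_derivative D) (at_right T)"
      unfolding G_def ab prod.case D_def
      by (intro DERIV_cdivide DERIV_mult slope_flow_right_derivative T)
    ultimately show "\<exists>D\<le>0. (G p has_real_derivative D) (at_right T)" by blast
  qed (use xy t in auto)
  then have "exp (k * t) * slope (flow t v) x y \<le> hg_dist E x y"
    using hg_dist_pos[OF xy] by (simp add: G_def pos_divide_le_eq)
  then show ?thesis
    by (simp add: exp_minus field_simps)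
qed

lemma iterate_to_vec: "(resolvent l ^^ n) (to_vec f) = to_vec ((hg_resolvent E w l ^^ n) f)"
  by (induction n) (simp_all add: resolvent_def)

lemma hg_heat_flow:
  assumes "0 \<le> t"
  shows "hg_heat E w t f x / deg x = pot (flow t (to_vec f)) x"
proof -
  let ?X = "\<lambda>l. (resolvent l ^^ nat \<lfloor>t / l\<rfloor>) (to_vec f)"
  have "((\<lambda>l. of_vec (?X l) x) \<longlongrightarrow> of_vec (flow t (to_vec f)) x) (at_right 0)"
    unfolding of_vec_def by (intro tendsto_intros flow_tendsto assms)
  then have "hg_heat E w t f x = of_vec (flow t (to_vec f)) x"
    unfolding hg_heat_def iterate_to_vec of_vec_to_vec by (intro tendsto_Lim) auto
  then show ?thesis by (simp add: of_vec_div_deg)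
qed

end

text \<open>The infimum of the curvatures is an extended real, so the rate enters as a real lower
  bound \<open>k\<close>; when the infimum is finite, \<open>k\<close> can be that value
  itself.\<close>

theorem mainTheorem15:
  fixes E :: "'v::finite set set" and w :: "'v set \<Rightarrow> real"
  assumes "weighted_hypergraph E w"
    and "card (UNIV :: 'v set) \<ge> 2"
    and "f \<in> hg_Lip1w E w"
    and "t > 0"
    and "ereal k \<le> hg_kappa_bar0 E w"
  shows "hg_heat E w t f x / hg_deg E w x - hg_heat E w t f y / hg_deg E w y
           \<le> exp (- k * t) * real (hg_dist E x y)"
\<comment> \<open>Curvature concerns distinct vertices; on the diagonal the left side is 0 and the
  right side is nonnegative.\<close>
proof (cases "x = y")
  case False
  interpret weighted_hg E w by unfold_locales (rule assms(1))
  have "slope (flow t (to_vec f)) x y \<le> exp (- k * t) * hg_dist E x y"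
    using assms(3,4) by (intro slope_flow_decay assms(5) False) (auto simp: hg_Lip1w_iff)
  then show ?thesis
    using assms(4) by (simp add: hg_heat_flow slope_def)
qed simp

end
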